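(* Let $U=(U_1,U_0,U_{VE})$ be the solution of the complete discrete method (see context) with given initial state $U(t_0)$. Let $\hat U=(\hat U_1,\hat U_0,\hat U_{VE})$ be the function, continuous and piecewise linear in time on the grid $\{t_n\}_{n=0}^N$, with $\hat U(t_0)=U(t_0)$, computed successively for $n=1,\dots,N$ by the reduced method with reconstruction: (1) $\hat U_r=(\hat U_1,\hat U_0)\in V_{h,n}\times V_{h,n}$ on $I_n$ (continuous in time at $t_{n-1}$) solves $$\int_{I_n}A_r(\dot{\hat U}_r,W_r)+B_r(\hat U_r,W_r)\,dt=\int_{I_n}L_{k,r}(W_r)\,dt\qquad\forall W_r\in P_0V_{h,n}\times P_0V_{h,n};$$ (2) $\hat U_{VE}^m(t_n)=\alpha_{k_n}^m\left(\hat U_1(t_n)+\hat U_1(t_{n-1})\right)+\beta_{k_n}^m\hat U_{VE}^m(t_{n-1})$ for $m=1,\dots,M$. Here $\alpha_k^m=\dfrac{k}{2+k/\tau_m}$, $\beta_k^m=\dfrac{2-k/\tau_m}{2+k/\tau_m}$, and on $I_n$ $$A_r((\dot u_1,\dot u_0),(v_1,v_0))=(\rho\dot u_1,v_1)+a_E(\dot u_0,v_0),$$ $$B_r((u_1,u_0),(v_1,v_0))=a_E(u_0,v_1)-a_E(u_1,v_0)+\sum_{m=1}^M a_{VE}^m(\alpha_{k_n}^mu_1,v_1),$$ $$L_{k,r}((v_1,v_0))=(f,v_1)+(g_k,v_1)_{\Gamma_N}-\sum_{m=1}^M a_{VE}^m\left(\tfrac{1+\beta_{k_n}^m}{2}\hat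 U_{VE}^m(t_{n-1}),v_1\right).$$ Then the reconstructed solution of the reduced method is identical to the solution of the complete discrete method: $\hat U=U$.
   Context: $\Omega\subset\mathbb{R}^3$ is a bounded domain with piecewise smooth boundary $\partial\Omega=\Gamma_D\cup\Gamma_N$, $\Gamma_D\cap\Gamma_N=\emptyset$, where $\Gamma_D$ has non-zero area measure. $\rho>0$ is the density, $\mu,\lambda$ are Lamé parameters, $M\ge1$ is an integer, $\kappa_m,\tau_m>0$ ($m=1,\dots,M$). $f(t)$ is a body force and $g_k(t)$ a traction on $\Gamma_N$ that is piecewise linear in time. Let $\epsilon(w)=\frac12(\nabla w+(\nabla w)^T)$, $e(w)=\epsilon(w)-\frac13\mathrm{tr}(\epsilon(w))I$, $\sigma_E(w)=2\mu\,\epsilon(w)+\lambda\,\mathrm{tr}(\epsilon(w))I$, $\sigma_{VE}^m(w)=\kappa_me(w)$. Let $V=\{v\in[H^1(\Omega)]^3:v|_{\Gamma_D}=0\}$, let $(\cdot,\cdot)$ be the $L^2(\Omega)$ inner product, $a_E(v,w)=(\sigma_E(v),\epsilon(w))$, $a_{VE}^m(v,w)=(\sigma_{VE}^m(v),e(w))$. For $u=(u_1,u_0,u_{VE})$, $v=(v_1,v_0,v_{VE})\in V^{2+M}$, with $u_{VE}=(u_{VE}^1,\dots,u_{VE}^M)$, define $$A(u,v)=(\rho u_1,v_1)+a_E(u_0,v_0)+\sum_{m=1}^M a_{VE}^m(u_{VE}^m,v_{VE}^m),$$ $$B(u,v)=a_E(u_0,v_1)-a_E(u_1,v_0)+\sum_{m=1}^M\left[a_{VE}^m(u_{VE}^m,v_1)-a_{VE}^m(u_1,v_{VE}^m)+\tfrac1{\tau_m}a_{VE}^m(u_{VE}^m,v_{VE}^m)\right].$$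 The form $A$ is symmetric positive definite. $V_h\subset V$ is the finite element space of vector fields whose components are continuous piecewise polynomials of order $p$ on a tetrahedral mesh of $\Omega$. Let $0=t_0<t_1<\dots<t_N=T$, $I_n=(t_{n-1},t_n]$, $k_n=t_n-t_{n-1}$. $V_{h,n}$ denotes the functions on $I_n\times\Omega$ that are polynomials of degree $\le1$ in time with values in $V_h$, and $P_0V_{h,n}$ those constant in time with values in $V_h$. **Complete discrete method.** Given $U(t_0)\in V_h^{2+M}$, for $n=1,\dots,N$ find $U=(U_1,U_0,U_{VE})\in[V_{h,n}]^{2+M}$ on $I_n$ such that $U^+(t_{n-1})=U^-(t_{n-1})$ (continuity in time, with the given initial value at $t_0$) and $$\int_{I_n}A(\dot U,W)+B(U,W)\,dt=\int_{I_n}L_k(W)\,dt\qquad\forall W\in[P_0V_{h,n}]^{2+M},$$ where $L_k(v)=(f,v_1)+(g_k,v_1)_{\Gamma_N}$. *)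

theory Defs
  imports "HOL-Analysis.Analysis"
begin

type_synonym point = "real^3"
type_synonym field = "real^3 \<Rightarrow> real^3"


subsection \<open>Smooth functions, smooth surface pieces, area\<close>

primrec Ck_on :: "nat \<Rightarrow> 'a::euclidean_space set \<Rightarrow> ('a \<Rightarrow> 'b::real_normed_vector) \<Rightarrow> bool" where
  "Ck_on 0 W f \<longleftrightarrow> continuous_on W f"
| "Ck_on (Suc k) W f \<longleftrightarrow>
     f differentiable_on W \<and> (\<forall>i\<in>Basis. Ck_on k W (\<lambda>x. frechet_derivative f (at x) i))"

text \<open>Only used for open sets \<open>W\<close>.\<close>

definition smooth_on :: "'a::euclidean_space set \<Rightarrow> ('a \<Rightarrow> 'b::real_normed_vector) \<Rightarrow> bool" where
  "smooth_on W f \<longleftrightarrow> (\<forall>k. Ck_on k W f)"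

definition smooth_patch :: "point set \<Rightarrow> bool" where
  "smooth_patch S \<longleftrightarrow>
     (\<exists>(W :: (real^2) set) \<Delta> \<phi>. open W \<and> 2 simplex \<Delta> \<and> \<Delta> \<subseteq> W \<and> smooth_on W \<phi> \<and> inj_on \<phi> \<Delta> \<and>
        (\<forall>y\<in>W. inj (frechet_derivative \<phi> (at y))) \<and> S = \<phi> ` \<Delta>)"

definition piecewise_smooth_boundary :: "point set \<Rightarrow> bool" where
  "piecewise_smooth_boundary \<Omega> \<longleftrightarrow>
     (\<exists>\<P>. finite \<P> \<and> (\<forall>S\<in>\<P>. smooth_patch S) \<and> frontier \<Omega> = \<Union>\<P>)"

text \<open>
  Area is the two-dimensional Hausdorff measure. The factor \<open>pi / 4\<close> normalises it so that it is
  the surface measure on smooth surfaces. As \<open>hausdorff2\<close> is a metric outer measure, it is countably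
  additive on the Borel sets, so that \<open>emeasure area_measure\<close> is \<open>hausdorff2\<close> there.
\<close>

definition covers2 :: "real \<Rightarrow> point set \<Rightarrow> (nat \<Rightarrow> point set) set" where
  "covers2 \<delta> A = {C. A \<subseteq> (\<Union>i. C i) \<and> (\<forall>i. bounded (C i) \<and> diameter (C i) \<le> \<delta>)}"

definition hausdorff2_pre :: "real \<Rightarrow> point set \<Rightarrow> ennreal" where
  "hausdorff2_pre \<delta> A = (INF C\<in>covers2 \<delta> A. \<Sum>i. ennreal (pi / 4 * (diameter (C i))\<^sup>2))"

definition hausdorff2 :: "point set \<Rightarrow> ennreal" where
  "hausdorff2 A = (SUP \<delta>\<in>{0<..}. hausdorff2_pre \<delta> A)"

definition area_measure :: "point measure" where
  "area_measure = measure_of UNIV (sets borel) hausdorff2"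


subsection \<open>\<open>L\<^sup>2\<close> and \<open>H\<^sup>1\<close>\<close>

definition L2_space :: "'a measure \<Rightarrow> ('a \<Rightarrow> 'b::euclidean_space) set" where
  "L2_space N = {f. f \<in> borel_measurable N \<and> integrable N (\<lambda>x. (norm (f x))\<^sup>2)}"

definition L2_inner :: "'a measure \<Rightarrow> ('a \<Rightarrow> 'b::euclidean_space) \<Rightarrow> ('a \<Rightarrow> 'b) \<Rightarrow> real" where
  "L2_inner N f g = (\<integral>x. f x \<bullet> g x \<partial>N)"

definition L2_norm :: "'a measure \<Rightarrow> ('a \<Rightarrow> 'b::euclidean_space) \<Rightarrow> real" where
  "L2_norm N f = sqrt (L2_inner N f f)"

definition test_function :: "point set \<Rightarrow> (point \<Rightarrow> real) \<Rightarrow> bool" where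
  "test_function \<Omega> \<phi> \<longleftrightarrow>
     smooth_on UNIV \<phi> \<and> (\<exists>K. compact K \<and> K \<subseteq> \<Omega> \<and> (\<forall>x. x \<notin> K \<longrightarrow> \<phi> x = 0))"

definition has_weak_gradient :: "point set \<Rightarrow> (point \<Rightarrow> real) \<Rightarrow> field \<Rightarrow> bool" where
  "has_weak_gradient \<Omega> w G \<longleftrightarrow>
     (\<forall>\<phi>. test_function \<Omega> \<phi> \<longrightarrow>
        (\<forall>j. (\<integral>x. w x * frechet_derivative \<phi> (at x) (axis j 1) \<partial>lebesgue_on \<Omega>) =
             - (\<integral>x. G x $ j * \<phi> x \<partial>lebesgue_on \<Omega>)))"

definition H1_space :: "point set \<Rightarrow> (point \<Rightarrow> real) set" where
  "H1_space \<Omega> = {w \<in> L2_space (lebesgue_on \<Omega>).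
     \<exists>G\<in>L2_space (lebesgue_on \<Omega>). has_weak_gradient \<Omega> w G}"

text \<open>The weak gradient is determined up to null sets; some representative is chosen.\<close>

definition weak_gradient :: "point set \<Rightarrow> (point \<Rightarrow> real) \<Rightarrow> field" where
  "weak_gradient \<Omega> w = (SOME G. G \<in> L2_space (lebesgue_on \<Omega>) \<and> has_weak_gradient \<Omega> w G)"

definition H1_fields :: "point set \<Rightarrow> field set" where
  "H1_fields \<Omega> = {v. \<forall>i. (\<lambda>x. v x $ i) \<in> H1_space \<Omega>}"

text \<open>Row \<open>i\<close> of the gradient of a field is the gradient of its \<open>i\<close>-th component.\<close>

definition grad :: "point set \<Rightarrow> field \<Rightarrow> point \<Rightarrow> real^3^3" where
  "grad \<Omega> v x = (\<chi> i. weak_gradient \<Omega> (\<lambda>y. v y $ i) x)"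

text \<open>
  The trace is the continuous extension to \<open>H\<^sup>1\<close> of the restriction of smooth functions to the
  boundary. A field thus has zero trace on \<open>\<Gamma>\<close> iff it is an \<open>H\<^sup>1\<close> limit of smooth fields whose
  restrictions to \<open>\<Gamma>\<close> tend to zero in \<open>L\<^sup>2\<close>.
\<close>

definition zero_trace_on :: "point set \<Rightarrow> point set \<Rightarrow> field \<Rightarrow> bool" where
  "zero_trace_on \<Omega> \<Gamma> v \<longleftrightarrow>
     (\<exists>\<phi> :: nat \<Rightarrow> field. (\<forall>j. smooth_on UNIV (\<phi> j)) \<and>
        (\<lambda>j. \<integral>\<^sup>+x. ennreal ((norm (\<phi> j x - v x))\<^sup>2) \<partial>lebesgue_on \<Omega>) \<longlonglongrightarrow> 0 \<and>
        (\<lambda>j. \<integral>\<^sup>+x. ennreal ((norm (matrix (frechet_derivative (\<phi> j) (at x)) - grad \<Omega> v x))\<^sup>2)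
               \<partial>lebesgue_on \<Omega>) \<longlonglongrightarrow> 0 \<and>
        (\<lambda>j. \<integral>\<^sup>+x. ennreal ((norm (\<phi> j x))\<^sup>2) \<partial>restrict_space area_measure \<Gamma>) \<longlonglongrightarrow> 0)"

definition V_space :: "point set \<Rightarrow> point set \<Rightarrow> field set" where
  "V_space \<Omega> \<Gamma>D = {v \<in> H1_fields \<Omega>. zero_trace_on \<Omega> \<Gamma>D v}"


subsection \<open>Strain, stress and the bilinear forms\<close>

definition strain :: "point set \<Rightarrow> field \<Rightarrow> point \<Rightarrow> real^3^3" where
  "strain \<Omega> w x = (1/2) *\<^sub>R (grad \<Omega> w x + transpose (grad \<Omega> w x))"

definition dev_strain :: "point set \<Rightarrow> field \<Rightarrow> point \<Rightarrow> real^3^3" where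
  "dev_strain \<Omega> w x = strain \<Omega> w x - ((1/3) * trace (strain \<Omega> w x)) *\<^sub>R mat 1"

definition stress_E :: "point set \<Rightarrow> real \<Rightarrow> real \<Rightarrow> field \<Rightarrow> point \<Rightarrow> real^3^3" where
  "stress_E \<Omega> \<mu> lam w x = (2 * \<mu>) *\<^sub>R strain \<Omega> w x + (lam * trace (strain \<Omega> w x)) *\<^sub>R mat 1"

definition stress_VE :: "point set \<Rightarrow> real \<Rightarrow> field \<Rightarrow> point \<Rightarrow> real^3^3" where
  "stress_VE \<Omega> \<kappa> w x = \<kappa> *\<^sub>R dev_strain \<Omega> w x"

text \<open>The inner product of \<open>real^3^3\<close> is the Frobenius product.\<close>

definition a_E :: "point set \<Rightarrow> real \<Rightarrow> real \<Rightarrow> field \<Rightarrow> field \<Rightarrow> real" where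
  "a_E \<Omega> \<mu> lam v w = L2_inner (lebesgue_on \<Omega>) (stress_E \<Omega> \<mu> lam v) (strain \<Omega> w)"

definition a_VE :: "point set \<Rightarrow> real \<Rightarrow> field \<Rightarrow> field \<Rightarrow> real" where
  "a_VE \<Omega> \<kappa> v w = L2_inner (lebesgue_on \<Omega>) (stress_VE \<Omega> \<kappa> v) (dev_strain \<Omega> w)"

text \<open>
  A state \<open>(u1, u0, uVE)\<close> consists of velocity, displacement and the internal variables
  \<open>uVE m\<close>, of which only those with \<open>m \<in> {1..M}\<close> are relevant.
\<close>

type_synonym state = "field \<times> field \<times> (nat \<Rightarrow> field)"

definition state_space :: "nat \<Rightarrow> field set \<Rightarrow> state set" where
  "state_space M S = {(u1, u0, uVE). u1 \<in> S \<and> u0 \<in> S \<and> (\<forall>m\<in>{1..M}. uVE m \<in> S)}"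

fun state_eq_on :: "point set \<Rightarrow> nat \<Rightarrow> state \<Rightarrow> state \<Rightarrow> bool" where
  "state_eq_on X M (u1, u0, uVE) (v1, v0, vVE) \<longleftrightarrow>
     (\<forall>x\<in>X. u1 x = v1 x \<and> u0 x = v0 x \<and> (\<forall>m\<in>{1..M}. uVE m x = vVE m x))"

fun state_null :: "point set \<Rightarrow> nat \<Rightarrow> state \<Rightarrow> bool" where
  "state_null \<Omega> M (u1, u0, uVE) \<longleftrightarrow>
     (AE x in lebesgue_on \<Omega>. u1 x = 0 \<and> u0 x = 0 \<and> (\<forall>m\<in>{1..M}. uVE m x = 0))"

fun A_form :: "point set \<Rightarrow> real \<Rightarrow> real \<Rightarrow> real \<Rightarrow> nat \<Rightarrow> (nat \<Rightarrow> real) \<Rightarrow> state \<Rightarrow> state \<Rightarrow> real" where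
  "A_form \<Omega> \<rho> \<mu> lam M \<kappa> (u1, u0, uVE) (v1, v0, vVE) =
     L2_inner (lebesgue_on \<Omega>) (\<lambda>x. \<rho> *\<^sub>R u1 x) v1 + a_E \<Omega> \<mu> lam u0 v0 +
     (\<Sum>m=1..M. a_VE \<Omega> (\<kappa> m) (uVE m) (vVE m))"

fun B_form :: "point set \<Rightarrow> real \<Rightarrow> real \<Rightarrow> nat \<Rightarrow> (nat \<Rightarrow> real) \<Rightarrow> (nat \<Rightarrow> real) \<Rightarrow>
    state \<Rightarrow> state \<Rightarrow> real" where
  "B_form \<Omega> \<mu> lam M \<kappa> \<tau> (u1, u0, uVE) (v1, v0, vVE) =
     a_E \<Omega> \<mu> lam u0 v1 - a_E \<Omega> \<mu> lam u1 v0 +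
     (\<Sum>m=1..M. a_VE \<Omega> (\<kappa> m) (uVE m) v1 - a_VE \<Omega> (\<kappa> m) u1 (vVE m)
                + (1 / \<tau> m) * a_VE \<Omega> (\<kappa> m) (uVE m) (vVE m))"

text \<open>Elements of \<open>H\<^sup>1\<close> are identified up to null sets, so nonzero means not null.\<close>

definition symmetric_positive_definite :: "point set \<Rightarrow> nat \<Rightarrow> state set \<Rightarrow>
    (state \<Rightarrow> state \<Rightarrow> real) \<Rightarrow> bool" where
  "symmetric_positive_definite \<Omega> M S A \<longleftrightarrow>
     (\<forall>u\<in>S. \<forall>v\<in>S. A u v = A v u) \<and> (\<forall>u\<in>S. \<not> state_null \<Omega> M u \<longrightarrow> A u u > 0)"

definition load :: "point set \<Rightarrow> point set \<Rightarrow> field \<Rightarrow> field \<Rightarrow> field \<Rightarrow> real" where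
  "load \<Omega> \<Gamma>N f g v = L2_inner (lebesgue_on \<Omega>) f v + L2_inner (restrict_space area_measure \<Gamma>N) g v"


subsection \<open>Finite elements in space, piecewise linear functions in time\<close>

definition tetrahedral_mesh :: "point set \<Rightarrow> point set set \<Rightarrow> bool" where
  "tetrahedral_mesh \<Omega> \<T> \<longleftrightarrow> triangulation \<T> \<and> (\<forall>K\<in>\<T>. 3 simplex K) \<and> \<Union>\<T> = closure \<Omega>"

definition polynomial_of_order :: "nat \<Rightarrow> (point \<Rightarrow> real) \<Rightarrow> bool" where
  "polynomial_of_order p q \<longleftrightarrow>
     (\<exists>c. \<forall>x. q x = (\<Sum>(i, j, k)\<in>{(i, j, k). i + j + k \<le> p}. c i j k * (x$1)^i * (x$2)^j * (x$3)^k))"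

text \<open>
  Finite element functions are functions on \<open>closure \<Omega>\<close>, encoded as total functions whose values
  elsewhere do not matter.
\<close>

definition FE_space :: "point set \<Rightarrow> point set \<Rightarrow> point set set \<Rightarrow> nat \<Rightarrow> field set" where
  "FE_space \<Omega> \<Gamma>D \<T> p = {v \<in> V_space \<Omega> \<Gamma>D. continuous_on (closure \<Omega>) v \<and>
     (\<forall>K\<in>\<T>. \<forall>i. \<exists>q. polynomial_of_order p q \<and> (\<forall>x\<in>K. v x $ i = q x))}"

definition time_grid :: "nat \<Rightarrow> real \<Rightarrow> (nat \<Rightarrow> real) \<Rightarrow> bool" where
  "time_grid N T t \<longleftrightarrow> 1 \<le> N \<and> t 0 = 0 \<and> t N = T \<and> (\<forall>n\<in>{1..N}. t (n - 1) < t n)"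

definition time_cell :: "(nat \<Rightarrow> real) \<Rightarrow> nat \<Rightarrow> real set" where
  "time_cell t n = {t (n - 1)<..t n}"

definition time_step :: "(nat \<Rightarrow> real) \<Rightarrow> nat \<Rightarrow> real" where
  "time_step t n = t n - t (n - 1)"

text \<open>
  \<open>P1_time X I S\<close> and \<open>P0_time X I S\<close>: functions on \<open>I \<times> X\<close> that are affine, respectively constant,
  in time on \<open>I\<close>, with coefficients in \<open>S\<close>. The spaces of the discrete method on the cell \<open>I\<close> are
  those with \<open>X = closure \<Omega>\<close> and \<open>S\<close> the finite element space.
\<close>

definition P1_time :: "point set \<Rightarrow> real set \<Rightarrow> field set \<Rightarrow> (real \<Rightarrow> field) set" where
  "P1_time X I S = {w. \<exists>a\<in>S. \<exists>b\<in>S. \<forall>s\<in>I. \<forall>x\<in>X. w s x = a x + s *\<^sub>R b x}"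

definition P0_time :: "point set \<Rightarrow> real set \<Rightarrow> field set \<Rightarrow> (real \<Rightarrow> field) set" where
  "P0_time X I S = {w. \<exists>a\<in>S. \<forall>s\<in>I. \<forall>x\<in>X. w s x = a x}"

definition time_deriv :: "real set \<Rightarrow> (real \<Rightarrow> field) \<Rightarrow> real \<Rightarrow> field" where
  "time_deriv I w s x = vector_derivative (\<lambda>r. w r x) (at s within I)"

text \<open>
  Time cells are closed on the right, so the value at a grid point \<open>s\<close> is the left limit (at the
  initial time, the initial value), and continuity at \<open>s\<close> is convergence from the right.
\<close>

definition right_continuous :: "point set \<Rightarrow> (real \<Rightarrow> field) \<Rightarrow> real \<Rightarrow> bool" where
  "right_continuous X w s \<longleftrightarrow> (\<forall>x\<in>X. ((\<lambda>r. w r x) \<longlongrightarrow> w s x) (at_right s))"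


subsection \<open>Data\<close>

definition L1_in_time_L2 :: "point set \<Rightarrow> real \<Rightarrow> (real \<Rightarrow> field) \<Rightarrow> bool" where
  "L1_in_time_L2 \<Omega> T f \<longleftrightarrow>
     (\<lambda>(s, x). f s x) \<in> borel_measurable (lebesgue_on {0..T} \<Otimes>\<^sub>M lebesgue_on \<Omega>) \<and>
     (AE s in lebesgue_on {0..T}. f s \<in> L2_space (lebesgue_on \<Omega>)) \<and>
     integrable (lebesgue_on {0..T}) (\<lambda>s. L2_norm (lebesgue_on \<Omega>) (f s))"

definition piecewise_linear_in_time :: "point set \<Rightarrow> nat \<Rightarrow> (nat \<Rightarrow> real) \<Rightarrow> (real \<Rightarrow> field) \<Rightarrow> bool" where
  "piecewise_linear_in_time \<Gamma>N N t g \<longleftrightarrow>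
     (\<forall>n\<in>{1..N}. g \<in> P1_time \<Gamma>N (time_cell t n) (L2_space (restrict_space area_measure \<Gamma>N)))"


subsection \<open>The complete discrete method\<close>

definition complete_method :: "point set \<Rightarrow> point set \<Rightarrow> real \<Rightarrow> real \<Rightarrow> real \<Rightarrow> nat \<Rightarrow>
    (nat \<Rightarrow> real) \<Rightarrow> (nat \<Rightarrow> real) \<Rightarrow> (real \<Rightarrow> field) \<Rightarrow> (real \<Rightarrow> field) \<Rightarrow> field set \<Rightarrow>
    nat \<Rightarrow> (nat \<Rightarrow> real) \<Rightarrow> state \<Rightarrow>
    (real \<Rightarrow> field) \<Rightarrow> (real \<Rightarrow> field) \<Rightarrow> (nat \<Rightarrow> real \<Rightarrow> field) \<Rightarrow> bool" where
  "complete_method \<Omega> \<Gamma>N \<rho> \<mu> lam M \<kappa> \<tau> f g Vh N t init U1 U0 UVE \<longleftrightarrow>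
     state_eq_on (closure \<Omega>) M (U1 (t 0), U0 (t 0), \<lambda>m. UVE m (t 0)) init \<and>
     (\<forall>n\<in>{1..N}. let I = time_cell t n; X = closure \<Omega> in
        U1 \<in> P1_time X I Vh \<and> U0 \<in> P1_time X I Vh \<and> (\<forall>m\<in>{1..M}. UVE m \<in> P1_time X I Vh) \<and>
        right_continuous X U1 (t (n - 1)) \<and> right_continuous X U0 (t (n - 1)) \<and>
        (\<forall>m\<in>{1..M}. right_continuous X (UVE m) (t (n - 1))) \<and>
        (\<forall>W1 W0 WVE. W1 \<in> P0_time X I Vh \<and> W0 \<in> P0_time X I Vh \<and>
             (\<forall>m\<in>{1..M}. WVE m \<in> P0_time X I Vh) \<longrightarrow>
           (\<integral>s. A_form \<Omega> \<rho> \<mu> lam M \<kappa>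
                  (time_deriv I U1 s, time_deriv I U0 s, \<lambda>m. time_deriv I (UVE m) s)
                  (W1 s, W0 s, \<lambda>m. WVE m s)
                + B_form \<Omega> \<mu> lam M \<kappa> \<tau>
                  (U1 s, U0 s, \<lambda>m. UVE m s) (W1 s, W0 s, \<lambda>m. WVE m s) \<partial>lebesgue_on I)
           = (\<integral>s. load \<Omega> \<Gamma>N (f s) (g s) (W1 s) \<partial>lebesgue_on I)))"


subsection \<open>The reduced method with reconstruction\<close>

definition \<alpha>_coeff :: "real \<Rightarrow> real \<Rightarrow> real" where
  "\<alpha>_coeff k \<tau> = k / (2 + k / \<tau>)"

definition \<beta>_coeff :: "real \<Rightarrow> real \<Rightarrow> real" where
  "\<beta>_coeff k \<tau> = (2 - k / \<tau>) / (2 + k / \<tau>)"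

fun Ar_form :: "point set \<Rightarrow> real \<Rightarrow> real \<Rightarrow> real \<Rightarrow> field \<times> field \<Rightarrow> field \<times> field \<Rightarrow> real" where
  "Ar_form \<Omega> \<rho> \<mu> lam (u1, u0) (v1, v0) =
     L2_inner (lebesgue_on \<Omega>) (\<lambda>x. \<rho> *\<^sub>R u1 x) v1 + a_E \<Omega> \<mu> lam u0 v0"

fun Br_form :: "point set \<Rightarrow> real \<Rightarrow> real \<Rightarrow> nat \<Rightarrow> (nat \<Rightarrow> real) \<Rightarrow> (nat \<Rightarrow> real) \<Rightarrow> real \<Rightarrow>
    field \<times> field \<Rightarrow> field \<times> field \<Rightarrow> real" where
  "Br_form \<Omega> \<mu> lam M \<kappa> \<tau> k (u1, u0) (v1, v0) =
     a_E \<Omega> \<mu> lam u0 v1 - a_E \<Omega> \<mu> lam u1 v0 +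
     (\<Sum>m=1..M. a_VE \<Omega> (\<kappa> m) (\<lambda>x. \<alpha>_coeff k (\<tau> m) *\<^sub>R u1 x) v1)"

definition reduced_load :: "point set \<Rightarrow> point set \<Rightarrow> nat \<Rightarrow> (nat \<Rightarrow> real) \<Rightarrow> (nat \<Rightarrow> real) \<Rightarrow> real \<Rightarrow>
    (nat \<Rightarrow> field) \<Rightarrow> field \<Rightarrow> field \<Rightarrow> field \<Rightarrow> real" where
  "reduced_load \<Omega> \<Gamma>N M \<kappa> \<tau> k uVE f g v1 =
     load \<Omega> \<Gamma>N f g v1 -
     (\<Sum>m=1..M. a_VE \<Omega> (\<kappa> m) (\<lambda>x. ((1 + \<beta>_coeff k (\<tau> m)) / 2) *\<^sub>R uVE m x) v1)"

definition reduced_method :: "point set \<Rightarrow> point set \<Rightarrow> real \<Rightarrow> real \<Rightarrow> real \<Rightarrow> nat \<Rightarrow>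
    (nat \<Rightarrow> real) \<Rightarrow> (nat \<Rightarrow> real) \<Rightarrow> (real \<Rightarrow> field) \<Rightarrow> (real \<Rightarrow> field) \<Rightarrow> field set \<Rightarrow>
    nat \<Rightarrow> (nat \<Rightarrow> real) \<Rightarrow> state \<Rightarrow>
    (real \<Rightarrow> field) \<Rightarrow> (real \<Rightarrow> field) \<Rightarrow> (nat \<Rightarrow> real \<Rightarrow> field) \<Rightarrow> bool" where
  "reduced_method \<Omega> \<Gamma>N \<rho> \<mu> lam M \<kappa> \<tau> f g Vh N t init U1 U0 UVE \<longleftrightarrow>
     state_eq_on (closure \<Omega>) M (U1 (t 0), U0 (t 0), \<lambda>m. UVE m (t 0)) init \<and>
     (\<forall>n\<in>{1..N}. let I = time_cell t n; k = time_step t n; X = closure \<Omega> in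
        U1 \<in> P1_time X I Vh \<and> U0 \<in> P1_time X I Vh \<and>
        (\<forall>m\<in>{1..M}. UVE m \<in> P1_time X I UNIV) \<and>
        right_continuous X U1 (t (n - 1)) \<and> right_continuous X U0 (t (n - 1)) \<and>
        (\<forall>m\<in>{1..M}. right_continuous X (UVE m) (t (n - 1))) \<and>
        (\<forall>W1 W0. W1 \<in> P0_time X I Vh \<and> W0 \<in> P0_time X I Vh \<longrightarrow>
           (\<integral>s. Ar_form \<Omega> \<rho> \<mu> lam (time_deriv I U1 s, time_deriv I U0 s) (W1 s, W0 s)
                + Br_form \<Omega> \<mu> lam M \<kappa> \<tau> k (U1 s, U0 s) (W1 s, W0 s) \<partial>lebesgue_on I)
           = (\<integral>s. reduced_load \<Omega> \<Gamma>N M \<kappa> \<tau> k (\<lambda>m. UVE m (t (n - 1))) (f s) (g s) (W1 s)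
                \<partial>lebesgue_on I)) \<and>
        (\<forall>m\<in>{1..M}. \<forall>x\<in>X. UVE m (t n) x =
           \<alpha>_coeff k (\<tau> m) *\<^sub>R (U1 (t n) x + U1 (t (n - 1)) x)
           + \<beta>_coeff k (\<tau> m) *\<^sub>R UVE m (t (n - 1)) x))"

end

(*
  On a cell of length k both methods only involve the values at the two grid points. Testing the
  complete method with an internal variable alone and using that a_VE is definite on the finite
  element space gives the update formula (2) pointwise. Substituting it into the remaining equation,
  the average of the internal variable over the cell turns into alpha times the average velocity
  plus (1 + beta) / 2 times the old internal variable, which is the reduced equation. That equation
  has at most one solution: testing the difference of two solutions with itself, the elastic
  coupling cancels by symmetry, and a sum of nonnegative terms has to vanish.

  The forms are bilinear only because weak gradients are unique up to null sets, for which the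
  fundamental lemma of the calculus of variations is needed.
*)

theory Submission
  imports Defs
begin

text \<open>Definiteness is assumed only for the full form \<open>A\<close>, and only up to null
  sets. The separate facts needed for each \<open>a_VE\<close> and for mass plus elasticity come
  from states whose other components vanish; continuity of finite element functions then turns
  vanishing almost everywhere into vanishing at every point of \<open>closure \<Omega>\<close>, the
  sense in which the solutions are compared.

  Fields are total functions whose values off \<open>closure \<Omega>\<close> are arbitrary, and
  gradients are chosen representatives. Linearity is therefore always stated for functions that
  agree with a linear combination on a set.

  In the complete method the time integral of the load is just a functional of the test function.
  The reduced method subtracts a constant inside that integral, and the Bochner integral of a
  non-integrable function is 0, so separating the two parts requires integrability of the load in
  time.\<close>

subsection \<open>A smooth approximation of the indicator of a box\<close>

text \<open>For \<open>n = 0\<close> this is the classical smooth function exp(-1/y) extended by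
  zero. The powers of 1/y are included because differentiation produces them; derivatives are then
  linear combinations of members of the same family.\<close>

definition flat :: "nat \<Rightarrow> real \<Rightarrow> real" where
  "flat n y = (if y > 0 then inverse y ^ n * exp (- inverse y) else 0)"

lemma flat_tendsto_0: "(flat n \<longlongrightarrow> 0) (at 0)"
proof -
  \<comment> \<open>The substitution z = 1/y turns the limit from the right into decay at
    infinity.\<close>
  have "((\<lambda>z::real. z ^ n / exp z) \<longlongrightarrow> 0) at_top"
    by (rule tendsto_power_div_exp_0)
  then have "((\<lambda>y::real. inverse y ^ n / exp (inverse y)) \<longlongrightarrow> 0) (at_right 0)"
    by (rule filterlim_compose) (rule filterlim_inverse_at_top_right)
  then have R: "(flat n \<longlongrightarrow> 0) (at_right 0)"
    by (rule Lim_transform_eventually)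
       (auto simp: eventually_at_right_field flat_def exp_minus divide_inverse intro: exI[of _ 1])
  have L: "(flat n \<longlongrightarrow> 0) (at_left 0)"
    by (rule Lim_transform_eventually[OF tendsto_const])
       (auto simp: eventually_at_left_field flat_def intro!: exI[of _ "-1"])
  show ?thesis
    using R L by (simp add: filterlim_at_split)
qed

lemma flat_has_derivative:
  "(flat n has_real_derivative flat (n + 2) y - n * flat (n + 1) y) (at y)"
proof (cases y "0::real" rule: linorder_cases)
  case less
  have "((\<lambda>_. 0) has_real_derivative flat (n + 2) y - n * flat (n + 1) y) (at y)"
    using less by (simp add: flat_def)
  then show ?thesis
    by (rule has_field_derivative_transform_within_open[where S = "{..<0}"])
       (use less in \<open>auto simp: flat_def\<close>)
next
  case equal
  \<comment> \<open>At the origin the difference quotient of \<open>flat n\<close> is exactly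
    \<open>flat (n + 1)\<close>, so differentiability there reduces to
    \<open>flat_tendsto_0\<close>.\<close>
  have "(\<lambda>h. (flat n h - flat n 0) / (h - 0)) = flat (n + 1)"
    by (auto simp: flat_def field_simps)
  then show ?thesis
    using flat_tendsto_0[of "n + 1"] equal
    by (simp add: has_field_derivative_iff flat_def[of _ 0])
next
  case greater
  have "((\<lambda>y. inverse y ^ n * exp (- inverse y)) has_real_derivative
          flat (n + 2) y - n * flat (n + 1) y) (at y)"
    using greater
    by (auto intro!: derivative_eq_intros simp: flat_def) (cases n; auto simp: field_simps power_add)
  then show ?thesis
    by (rule has_field_derivative_transform_within_open[where S = "{0<..}"])
       (use greater in \<open>auto simp: flat_def\<close>)
qed

text \<open>The flat functions of affine coordinates generate an algebra closed under differentiation.\<close>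

inductive bump_algebra :: "('a::euclidean_space \<Rightarrow> real) \<Rightarrow> bool" where
  const: "bump_algebra (\<lambda>x. c)"
| flat: "bump_algebra (\<lambda>x. flat n (a \<bullet> x + d))"
| add: "bump_algebra f \<Longrightarrow> bump_algebra g \<Longrightarrow> bump_algebra (\<lambda>x. f x + g x)"
| mult: "bump_algebra f \<Longrightarrow> bump_algebra g \<Longrightarrow> bump_algebra (\<lambda>x. f x * g x)"

lemma bump_algebra_derivative:
  fixes f :: "'a::euclidean_space \<Rightarrow> real"
  assumes "bump_algebra f"
  shows "\<exists>f'. (\<forall>x. (f has_derivative f' x) (at x)) \<and> (\<forall>i. bump_algebra (\<lambda>x. f' x i))"
  using assms
proof induction
  case (const c)
  show ?case
    by (rule exI[of _ "\<lambda>x i. 0"]) (auto intro: bump_algebra.const)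
next
  case (flat n a d)
  have "((\<lambda>x. flat n (a \<bullet> x + d)) has_derivative
      (\<lambda>i. (flat (n + 2) (a \<bullet> x + d) + (- real n) * flat (n + 1) (a \<bullet> x + d)) * (a \<bullet> i))) (at x)" for x
  proof -
    have "((\<lambda>x. a \<bullet> x + d) has_derivative (\<lambda>i. a \<bullet> i)) (at x)"
      by (auto intro!: derivative_eq_intros)
    from has_derivative_compose[OF this flat_has_derivative[of n, unfolded has_field_derivative_def]]
    show ?thesis by simp
  qed
  moreover have "bump_algebra
      (\<lambda>x. (flat (n + 2) (a \<bullet> x + d) + (- real n) * flat (n + 1) (a \<bullet> x + d)) * (a \<bullet> i))" for i
    by (intro bump_algebra.intros)
  ultimately show ?case
    by (intro exI[of _ "\<lambda>x i. (flat (n + 2) (a \<bullet> x + d) + (- real n) * flat (n + 1) (a \<bullet> x + d)) * (a \<bullet> i)"] conjI allI)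
next
  case (add f g)
  then obtain f' g' where
    "\<forall>x. (f has_derivative f' x) (at x)" "\<forall>i. bump_algebra (\<lambda>x. f' x i)"
    "\<forall>x. (g has_derivative g' x) (at x)" "\<forall>i. bump_algebra (\<lambda>x. g' x i)"
    by blast
  then show ?case
    by (intro exI[of _ "\<lambda>x i. f' x i + g' x i"])
       (auto intro: bump_algebra.intros has_derivative_add)
next
  case (mult f g)
  then obtain f' g' where *:
    "\<forall>x. (f has_derivative f' x) (at x)" "\<forall>i. bump_algebra (\<lambda>x. f' x i)"
    "\<forall>x. (g has_derivative g' x) (at x)" "\<forall>i. bump_algebra (\<lambda>x. g' x i)"
    by blast
  have "((\<lambda>x. f x * g x) has_derivative (\<lambda>i. f x * g' x i + f' x i * g x)) (at x)" for x
    using * by (intro has_derivative_mult) auto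
  moreover have "bump_algebra (\<lambda>x. f x * g' x i + f' x i * g x)" for i
    using * mult.hyps by (intro bump_algebra.intros) auto
  ultimately show ?case
    by (intro exI[of _ "\<lambda>x i. f x * g' x i + f' x i * g x"] conjI allI)
qed

lemma bump_algebra_prod:
  "finite A \<Longrightarrow> (\<And>i. i \<in> A \<Longrightarrow> bump_algebra (f i)) \<Longrightarrow> bump_algebra (\<lambda>x. \<Prod>i\<in>A. f i x)"
  by (induction A rule: finite_induct) (auto intro: bump_algebra.intros)

text \<open>Directional derivatives stay in the algebra, so induction on the order, with the
  function generalised, lifts differentiability to all orders.\<close>

lemma bump_algebra_smooth:
  assumes "bump_algebra f"
  shows "smooth_on UNIV f"
proof -
  have "Ck_on k UNIV f" for k
    using assms
  proof (induction k arbitrary: f)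
    case 0
    then show ?case
      using bump_algebra_derivative[OF 0]
      by (metis Ck_on.simps(1) continuous_at_imp_continuous_on has_derivative_continuous)
  next
    case (Suc k)
    obtain f' where f': "\<forall>x. (f has_derivative f' x) (at x)" "\<forall>i. bump_algebra (\<lambda>x. f' x i)"
      using bump_algebra_derivative[OF Suc.prems] by blast
    have "frechet_derivative f (at x) = f' x" for x
      using f'(1) frechet_derivative_at by metis
    with f' Suc.IH show ?case
      by (auto simp: differentiable_on_def differentiable_def)
  qed
  then show ?thesis
    by (simp add: smooth_on_def)
qed

text \<open>Two flat factors per coordinate vanish at the two faces of the box. Raising
  \<open>j\<close> steepens them: inside the open box every factor tends to exp 0 = 1, while outside
  the product is 0 for every \<open>j\<close>. The limit is the indicator itself, and the uniform
  bound 1 allows dominated convergence.\<close>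

definition box_bump :: "'a::euclidean_space \<Rightarrow> 'a \<Rightarrow> nat \<Rightarrow> 'a \<Rightarrow> real" where
  "box_bump a b j x =
     (\<Prod>i\<in>Basis. flat 0 (real j * (x \<bullet> i - a \<bullet> i)) * flat 0 (real j * (b \<bullet> i - x \<bullet> i)))"

lemma flat_0_bounds: "0 \<le> flat 0 y" "flat 0 y \<le> 1"
  by (auto simp: flat_def)

lemma box_bump_smooth: "smooth_on UNIV (box_bump a b j)"
proof (rule bump_algebra_smooth)
  have "bump_algebra (\<lambda>x. flat 0 (real j * (x \<bullet> i - a \<bullet> i)) * flat 0 (real j * (b \<bullet> i - x \<bullet> i)))" for i
    using bump_algebra.mult[OF
        bump_algebra.flat[of 0 "real j *\<^sub>R i" "- (real j * (a \<bullet> i))"]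
        bump_algebra.flat[of 0 "- real j *\<^sub>R i" "real j * (b \<bullet> i)"]]
    by (simp add: inner_commute algebra_simps)
  then show "bump_algebra (box_bump a b j)"
    unfolding box_bump_def by (intro bump_algebra_prod) auto
qed

lemma box_bump_le_1: "\<bar>box_bump a b j x\<bar> \<le> 1"
proof -
  have "0 \<le> box_bump a b j x" "box_bump a b j x \<le> 1"
    unfolding box_bump_def
    by (auto intro!: prod_nonneg prod_le_1 mult_nonneg_nonneg mult_le_one flat_0_bounds)
  then show ?thesis by simp
qed

lemma box_bump_outside:
  assumes "x \<notin> box a b"
  shows "box_bump a b j x = 0"
proof -
  obtain i where i: "i \<in> Basis" "x \<bullet> i \<le> a \<bullet> i \<or> b \<bullet> i \<le> x \<bullet> i"
    using assms by (force simp: mem_box)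
  then have "flat 0 (real j * (x \<bullet> i - a \<bullet> i)) * flat 0 (real j * (b \<bullet> i - x \<bullet> i)) = 0"
    by (auto simp: flat_def zero_less_mult_iff)
  with i show ?thesis
    unfolding box_bump_def by (intro prod_zero) auto
qed

lemma flat_0_tendsto_1:
  assumes "0 < c"
  shows "(\<lambda>j. flat 0 (real j * c)) \<longlonglongrightarrow> 1"
proof -
  have "(\<lambda>j. inverse (real j) * inverse c) \<longlonglongrightarrow> 0 * inverse c"
    by (intro tendsto_intros lim_inverse_n)
  then have "(\<lambda>j. exp (- inverse (real j * c))) \<longlonglongrightarrow> exp (- (0 * inverse c))"
    by (intro tendsto_intros) (simp add: inverse_mult_distrib)
  then have "(\<lambda>j. exp (- inverse (real j * c))) \<longlonglongrightarrow> 1"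
    by simp
  then show ?thesis
    by (rule Lim_transform_eventually)
       (use assms in \<open>auto simp: flat_def intro: eventually_mono[OF eventually_gt_at_top[of 0]]\<close>)
qed

lemma box_bump_tendsto_indicator: "(\<lambda>j. box_bump a b j x) \<longlonglongrightarrow> indicator (box a b) x"
proof (cases "x \<in> box a b")
  case True
  have "(\<lambda>j. box_bump a b j x) \<longlonglongrightarrow> (\<Prod>i\<in>(Basis :: 'a set). 1 * 1)"
    unfolding box_bump_def using True
    by (intro tendsto_intros flat_0_tendsto_1) (auto simp: mem_box)
  with True show ?thesis by simp
next
  case False
  then show ?thesis by (simp add: box_bump_outside)
qed

section \<open>The fundamental lemma of the calculus of variations\<close>

lemma AE_zero_if_box_integrals_zero:
  fixes h :: "'a::euclidean_space \<Rightarrow> real"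
  assumes h: "integrable lborel h"
    and box: "\<And>a b. (\<integral>x. indicator (box a b) x * h x \<partial>lborel) = 0"
  shows "AE x in lborel. h x = 0"
proof (rule sigma_finite_measure.density_zero[OF sigma_finite_lborel h])
  \<comment> \<open>Boxes are an intersection-stable generator of the Borel sets, and the Borel sets
    over which \<open>h\<close> integrates to zero form a Dynkin system. Hence \<open>h\<close> has
    zero integral over every Borel set, which is what \<open>density_zero\<close> asks for.\<close>
  let ?E = "range (\<lambda>(a, b). box a b :: 'a set)"
  have int: "set_integrable lborel A h" if "A \<in> sets borel" for A
    using integrable_mult_indicator[of A lborel h] h that by (simp add: set_integrable_def)
  \<comment> \<open>Closure under complements needs the integral over the whole space, which is not
    itself a box; growing boxes exhaust it.\<close>
  have total: "(\<integral>x. h x \<partial>lborel) = 0"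
  proof -
    have "(\<lambda>n. \<integral>x. indicator (box (- (real n *\<^sub>R One)) (real n *\<^sub>R One)) x * h x \<partial>lborel)
        \<longlonglongrightarrow> (\<integral>x. h x \<partial>lborel)"
    proof (rule integral_dominated_convergence[where w = "\<lambda>x. \<bar>h x\<bar>"])
      have "(\<lambda>n. indicator (box (- (real n *\<^sub>R One)) (real n *\<^sub>R One)) x * h x) \<longlonglongrightarrow> h x" for x :: 'a
      proof -
        obtain N where N: "x \<in> box (- (real N *\<^sub>R One)) (real N *\<^sub>R One)"
          using UN_box_eq_UNIV by blast
        have "eventually (\<lambda>n. indicator (box (- (real n *\<^sub>R One)) (real n *\<^sub>R One)) x * h x = h x) sequentially"
          using eventually_ge_at_top[of N]
        proof eventually_elim
          case (elim n)
          then have "real N \<le> real n" by simp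
          with N have "x \<in> box (- (real n *\<^sub>R One)) (real n *\<^sub>R One)"
            by (force simp: mem_box)
          then show ?case by simp
        qed
        then show ?thesis by (rule tendsto_eventually)
      qed
      then show "AE x in lborel. (\<lambda>n. indicator (box (- (real n *\<^sub>R One)) (real n *\<^sub>R One)) x * h x) \<longlonglongrightarrow> h x"
        by simp
    qed (use h in \<open>auto simp: indicator_def\<close>)
    then show ?thesis
      by (simp add: box LIMSEQ_const_iff)
  qed
  fix A :: "'a set" assume "A \<in> sets lborel"
  then have "A \<in> sigma_sets UNIV ?E"
    by (simp add: borel_eq_box)
  moreover have "Int_stable ?E" "?E \<subseteq> Pow UNIV"
    by (auto simp: Int_stable_def box_Int_box)
  ultimately have "Int_stable ?E" "?E \<subseteq> Pow UNIV" "A \<in> sigma_sets UNIV ?E"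
    by blast+
  then show "set_lebesgue_integral lborel A h = 0"
  proof (induction rule: sigma_sets_induct_disjoint)
    case (basic A)
    then show ?case
      using box by (auto simp: set_lebesgue_integral_def)
  next
    case empty
    then show ?case by (simp add: set_lebesgue_integral_def)
  next
    case (compl A)
    then have A: "A \<in> sets borel"
      by (simp add: borel_eq_box)
    have "set_lebesgue_integral lborel (A \<union> (UNIV - A)) h =
        set_lebesgue_integral lborel A h + set_lebesgue_integral lborel (UNIV - A) h"
      using A by (intro set_integral_Un int) auto
    moreover have "A \<union> (UNIV - A) = UNIV" by auto
    ultimately show ?case
      using total compl.IH by (simp add: set_lebesgue_integral_def)
  next
    case (union A)
    then have A: "A i \<in> sets borel" for i
      by (simp add: borel_eq_box image_subset_iff)
    have "set_lebesgue_integral lborel (\<Union>i. A i) h = (\<Sum>i. set_lebesgue_integral lborel (A i) h)"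
      using A union by (intro lebesgue_integral_countable_add int) (auto simp: disjoint_family_on_def)
    with union.IH show ?case by simp
  qed
qed

text \<open>Bumps converging to the indicator of a box make the integral of \<open>h\<close> over
  that box vanish, provided the closed box lies in \<Omega>. The criterion on boxes asks for all
  boxes of the space, so it is applied locally, and the local results are glued along a countable
  cover.\<close>

lemma fundamental_lemma_calculus_of_variations:
  fixes h :: "point \<Rightarrow> real"
  assumes op: "open \<Omega>" and h: "integrable (lebesgue_on \<Omega>) h"
    and test: "\<And>\<phi>. test_function \<Omega> \<phi> \<Longrightarrow> (\<integral>x. h x * \<phi> x \<partial>lebesgue_on \<Omega>) = 0"
  shows "AE x in lebesgue_on \<Omega>. h x = 0"
proof -
  define H where "H x = indicator \<Omega> x * h x" for x
  have [measurable]: "\<Omega> \<in> sets lebesgue"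
    using op by (simp add: borel_open)
  have H: "integrable lebesgue H"
    using h by (simp add: H_def[abs_def] integrable_restrict_space)
  note Hm = borel_measurable_integrable[OF H]
  have box_sets [measurable]: "box a b \<in> sets lebesgue" for a b :: point
    by simp
  have null: "(\<integral>x. indicator (box a b) x * H x \<partial>lebesgue) = 0" if ab: "cbox a b \<subseteq> \<Omega>" for a b
  proof -
    have bump: "(\<integral>x. box_bump a b j x * H x \<partial>lebesgue) = 0" for j
    proof -
      have "test_function \<Omega> (box_bump a b j)"
        unfolding test_function_def
      proof (intro conjI box_bump_smooth exI[of _ "cbox a b"] allI impI ab)
        show "box_bump a b j x = 0" if "x \<notin> cbox a b" for x
          using that box_subset_cbox[of a b] by (intro box_bump_outside) auto
      qed simp
      from test[OF this] show ?thesis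
        by (simp add: H_def integral_restrict_space mult_ac)
    qed
    have bump_m: "box_bump a b j \<in> borel_measurable lebesgue" for j
    proof -
      have "continuous_on UNIV (box_bump a b j)"
        using box_bump_smooth unfolding smooth_on_def by (metis Ck_on.simps(1))
      then show ?thesis
        by (intro measurable_completion) (simp add: borel_measurable_continuous_onI)
    qed
    have "(\<lambda>j. \<integral>x. box_bump a b j x * H x \<partial>lebesgue) \<longlonglongrightarrow>
        (\<integral>x. indicator (box a b) x * H x \<partial>lebesgue)"
    proof (rule integral_dominated_convergence[where w = "\<lambda>x. \<bar>H x\<bar>"])
      show "AE x in lebesgue. (\<lambda>j. box_bump a b j x * H x) \<longlonglongrightarrow> indicator (box a b) x * H x"
        by (intro AE_I2 tendsto_intros box_bump_tendsto_indicator)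
      show "AE x in lebesgue. norm (box_bump a b j x * H x) \<le> \<bar>H x\<bar>" for j
        using box_bump_le_1[of a b j] by (auto simp: abs_mult intro!: mult_left_le_one_le)
    qed (use H box_sets in \<open>auto intro!: borel_measurable_times bump_m Hm\<close>)
    then show ?thesis
      by (simp add: bump LIMSEQ_const_iff)
  qed
  have zero_on_box: "AE x in lebesgue. x \<in> box c d \<longrightarrow> h x = 0" if cd: "cbox c d \<subseteq> \<Omega>" for c d
  proof -
    \<comment> \<open>After cutting off with a box inside \<Omega>, every box can be tested: its
      intersection with \<open>box c d\<close> is empty or again a box, with closure in
      \<Omega>.\<close>
    define k where "k x = indicator (box c d) x * H x" for x
    have k: "integrable lebesgue k"
      using integrable_mult_indicator[OF box_sets H] by (simp add: k_def[abs_def])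
    \<comment> \<open>\<open>k\<close> is only Lebesgue measurable, whereas the box criterion is
      about \<open>lborel\<close>; a Borel representative mediates.\<close>
    then obtain g where g [measurable]: "g \<in> borel_measurable lborel"
      and kg: "AE x in lborel. k x = g x"
      using completion_ex_borel_measurable_real[OF borel_measurable_integrable[OF k]] by blast
    have [measurable]: "g \<in> borel_measurable lebesgue"
      using g by (rule measurable_completion)
    note [measurable] = borel_measurable_integrable[OF k]
    have kg': "AE x in lebesgue. k x = g x"
      using kg by (rule AE_completion)
    have "integrable lebesgue g"
      using k integrable_cong_AE[OF _ _ kg'] by simp
    then have "integrable lborel g"
      by (simp add: integrable_completion)
    moreover have "(\<integral>x. indicator (box a b) x * g x \<partial>lborel) = 0" for a b
    proof -
      have "(\<integral>x. indicator (box a b) x * g x \<partial>lborel) = (\<integral>x. indicator (box a b) x * g x \<partial>lebesgue)"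
        by (subst integral_completion) auto
      also have "\<dots> = (\<integral>x. indicator (box a b) x * k x \<partial>lebesgue)"
        by (rule integral_cong_AE) (use kg' in auto)
      also have "\<dots> = (\<integral>x. indicator (box a b \<inter> box c d) x * H x \<partial>lebesgue)"
        by (rule Bochner_Integration.integral_cong) (auto simp: k_def indicator_def)
      also have "\<dots> = 0"
      proof (cases "box a b \<inter> box c d = {}")
        case True
        then show ?thesis by simp
      next
        case False
        obtain l u where lu: "box a b \<inter> box c d = box l u"
          by (simp add: box_Int_box)
        then have "cbox l u = closure (box a b \<inter> box c d)"
          using False by (metis closure_box)
        also have "\<dots> \<subseteq> cbox c d"
          by (rule closure_minimal) (use box_subset_cbox in auto)
        finally show ?thesis
          using null[of l u] lu cd by auto
      qed
      finally show ?thesis .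
    qed
    ultimately have "AE x in lborel. g x = 0"
      by (rule AE_zero_if_box_integrals_zero)
    then have "AE x in lebesgue. g x = 0"
      by (rule AE_completion)
    with kg' show ?thesis
    proof eventually_elim
      case (elim x)
      then show ?case
        using cd box_subset_cbox by (auto simp: k_def H_def indicator_def split: if_splits)
    qed
  qed
  have zero_on_cbox: "AE x in lebesgue. x \<in> cbox c d \<longrightarrow> h x = 0" if cd: "cbox c d \<subseteq> \<Omega>" for c d
  proof -
    \<comment> \<open>The countable cover below consists of closed boxes, whose faces are
      negligible.\<close>
    have "cbox c d - box c d \<in> null_sets lebesgue"
      using negligible_frontier_interval by (simp add: negligible_iff_null_sets)
    then have "AE x in lebesgue. x \<notin> cbox c d - box c d"
      by (rule AE_not_in)
    with zero_on_box[OF cd] show ?thesis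
      by eventually_elim auto
  qed
  obtain D where D: "countable D" "D \<subseteq> Pow \<Omega>" "\<And>X. X \<in> D \<Longrightarrow> \<exists>a b. X = cbox a b" "\<Union>D = \<Omega>"
    using open_countable_Union_open_cbox[OF op] by metis
  have "AE x in lebesgue. \<forall>X\<in>D. x \<in> X \<longrightarrow> h x = 0"
  proof (subst AE_ball_countable[OF D(1)], rule ballI)
    fix X assume "X \<in> D"
    with D obtain a b where "X = cbox a b" "cbox a b \<subseteq> \<Omega>" by blast
    with zero_on_cbox show "AE x in lebesgue. x \<in> X \<longrightarrow> h x = 0" by simp
  qed
  then have "AE x in lebesgue. x \<in> \<Omega> \<longrightarrow> h x = 0"
    by eventually_elim (use D(4) in blast)
  then show ?thesis
    by (simp add: AE_restrict_space_iff)
qed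

subsection \<open>Square-integrable functions and weak gradients\<close>

lemma L2_space_cong:
  assumes "f \<in> L2_space N" "\<And>x. x \<in> space N \<Longrightarrow> f x = g x"
  shows "g \<in> L2_space N"
proof -
  have "integrable N (\<lambda>x. (norm (f x))\<^sup>2) = integrable N (\<lambda>x. (norm (g x))\<^sup>2)"
    by (rule Bochner_Integration.integrable_cong) (auto simp: assms(2))
  moreover have "f \<in> borel_measurable N \<longleftrightarrow> g \<in> borel_measurable N"
    by (rule measurable_cong) (rule assms(2))
  ultimately show ?thesis
    using assms(1) by (simp add: L2_space_def)
qed

lemma L2_space_bounded_linear:
  assumes P: "bounded_linear P" and f: "f \<in> L2_space N"
  shows "(\<lambda>x. P (f x)) \<in> L2_space N"
proof -
  obtain K where K: "\<And>x. norm (P x) \<le> norm x * K"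
    using bounded_linear.bounded[OF P] by blast
  have f_m: "f \<in> borel_measurable N" and f_i: "integrable N (\<lambda>x. (norm (f x))\<^sup>2)"
    using f by (auto simp: L2_space_def)
  have m: "(\<lambda>x. P (f x)) \<in> borel_measurable N"
    using borel_measurable_continuous_on[OF linear_continuous_on[OF P] f_m] .
  have "integrable N (\<lambda>x. (norm (P (f x)))\<^sup>2)"
  proof (rule Bochner_Integration.integrable_bound)
    show "integrable N (\<lambda>x. K\<^sup>2 * (norm (f x))\<^sup>2)"
      using f_i by simp
    show "AE x in N. norm ((norm (P (f x)))\<^sup>2) \<le> norm (K\<^sup>2 * (norm (f x))\<^sup>2)"
    proof (rule AE_I2)
      fix x
      have "(norm (P (f x)))\<^sup>2 \<le> (norm (f x) * K)\<^sup>2"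
        using K by (intro power_mono) auto
      then show "norm ((norm (P (f x)))\<^sup>2) \<le> norm (K\<^sup>2 * (norm (f x))\<^sup>2)"
        by (simp add: power_mult_distrib mult.commute)
    qed
  qed (use m in measurable)
  with m show ?thesis by (simp add: L2_space_def)
qed

lemma L2_space_integrable_inner:
  assumes "f \<in> L2_space N" "g \<in> L2_space N"
  shows "integrable N (\<lambda>x. f x \<bullet> g x)"
proof (rule Bochner_Integration.integrable_bound)
  show "integrable N (\<lambda>x. (norm (f x))\<^sup>2 + (norm (g x))\<^sup>2)"
    using assms by (auto simp: L2_space_def)
  have "f \<in> borel_measurable N" "g \<in> borel_measurable N"
    using assms by (auto simp: L2_space_def)
  then show "(\<lambda>x. f x \<bullet> g x) \<in> borel_measurable N"
    by (rule borel_measurable_inner)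
  show "AE x in N. norm (f x \<bullet> g x) \<le> norm ((norm (f x))\<^sup>2 + (norm (g x))\<^sup>2)"
  proof (rule AE_I2)
    fix x
    have "\<bar>f x \<bullet> g x\<bar> \<le> norm (f x) * norm (g x)"
      by (rule Cauchy_Schwarz_ineq2)
    also have "\<dots> \<le> (norm (f x))\<^sup>2 + (norm (g x))\<^sup>2"
      using sum_squares_bound[of "norm (f x)" "norm (g x)"]
        mult_nonneg_nonneg[OF norm_ge_zero[of "f x"] norm_ge_zero[of "g x"]] by linarith
    finally show "norm (f x \<bullet> g x) \<le> norm ((norm (f x))\<^sup>2 + (norm (g x))\<^sup>2)"
      by simp
  qed
qed

lemma norm_lincomb_square_le:
  "(norm (c *\<^sub>R x + d *\<^sub>R y))\<^sup>2 \<le> 2 * c\<^sup>2 * (norm x)\<^sup>2 + 2 * d\<^sup>2 * (norm y)\<^sup>2"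
proof -
  have "norm (c *\<^sub>R x + d *\<^sub>R y) \<le> \<bar>c\<bar> * norm x + \<bar>d\<bar> * norm y"
    using norm_triangle_ineq[of "c *\<^sub>R x" "d *\<^sub>R y"] by simp
  then have "(norm (c *\<^sub>R x + d *\<^sub>R y))\<^sup>2 \<le> (\<bar>c\<bar> * norm x + \<bar>d\<bar> * norm y)\<^sup>2"
    by (intro power_mono) auto
  also have "\<dots> \<le> 2 * (\<bar>c\<bar> * norm x)\<^sup>2 + 2 * (\<bar>d\<bar> * norm y)\<^sup>2"
    using sum_squares_bound[of "\<bar>c\<bar> * norm x" "\<bar>d\<bar> * norm y"]
    by (simp only: power2_sum)
  finally show ?thesis
    by (simp add: power_mult_distrib)
qed

lemma L2_space_lincomb:
  assumes "f \<in> L2_space N" "g \<in> L2_space N"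
  shows "(\<lambda>x. c *\<^sub>R f x + d *\<^sub>R g x) \<in> L2_space N"
proof -
  have [measurable]: "f \<in> borel_measurable N" "g \<in> borel_measurable N"
    using assms by (auto simp: L2_space_def)
  have "integrable N (\<lambda>x. (norm (c *\<^sub>R f x + d *\<^sub>R g x))\<^sup>2)"
  proof (rule Bochner_Integration.integrable_bound)
    show "integrable N (\<lambda>x. 2 * c\<^sup>2 * (norm (f x))\<^sup>2 + 2 * d\<^sup>2 * (norm (g x))\<^sup>2)"
      using assms by (auto simp: L2_space_def)
    show "AE x in N. norm ((norm (c *\<^sub>R f x + d *\<^sub>R g x))\<^sup>2)
        \<le> norm (2 * c\<^sup>2 * (norm (f x))\<^sup>2 + 2 * d\<^sup>2 * (norm (g x))\<^sup>2)"
      using norm_lincomb_square_le by (intro AE_I2) (simp add: abs_of_nonneg)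
  qed measurable
  then show ?thesis by (simp add: L2_space_def)
qed

text \<open>The combination is required only almost everywhere, since this is all that chosen weak
  gradients provide. Measurability of \<open>h\<close> is then a separate assumption, because an
  identity off a null set need not pass it on.\<close>

lemma L2_inner_lincomb_left:
  assumes "f \<in> L2_space N" "g \<in> L2_space N" "k \<in> L2_space N" "h \<in> borel_measurable N"
    and "AE x in N. h x = c *\<^sub>R f x + d *\<^sub>R g x"
  shows "L2_inner N h k = c * L2_inner N f k + d * L2_inner N g k"
proof -
  have [measurable]: "f \<in> borel_measurable N" "g \<in> borel_measurable N" "k \<in> borel_measurable N"
    using assms by (auto simp: L2_space_def)
  have "L2_inner N h k = (\<integral>x. c * (f x \<bullet> k x) + d * (g x \<bullet> k x) \<partial>N)"
    unfolding L2_inner_def using assms(5)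
    by (intro integral_cong_AE) (use assms(4) in \<open>auto simp: inner_simps elim!: eventually_mono\<close>)
  also have "\<dots> = c * L2_inner N f k + d * L2_inner N g k"
    unfolding L2_inner_def using assms L2_space_integrable_inner by (subst Bochner_Integration.integral_add) auto
  finally show ?thesis .
qed

lemma L2_inner_commute: "L2_inner N f g = L2_inner N g f"
  by (simp add: L2_inner_def inner_commute)

lemma L2_inner_lincomb_right:
  assumes "f \<in> L2_space N" "g \<in> L2_space N" "k \<in> L2_space N" "h \<in> borel_measurable N"
    and "AE x in N. h x = c *\<^sub>R f x + d *\<^sub>R g x"
  shows "L2_inner N k h = c * L2_inner N k f + d * L2_inner N k g"
  using L2_inner_lincomb_left[OF assms] by (simp add: L2_inner_commute)

section \<open>Weak gradients on a bounded open set\<close>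

locale bounded_open_domain =
  fixes \<Omega> :: "point set"
  assumes open_domain: "open \<Omega>" and bounded_domain: "bounded \<Omega>"
begin

lemma sets_domain [measurable, simp]: "\<Omega> \<in> sets lebesgue"
  using open_domain by (simp add: borel_open)

lemma lmeasurable_domain: "\<Omega> \<in> lmeasurable"
  using open_domain bounded_domain by (rule lmeasurable_open[rotated])

lemma finite_measure_domain: "finite_measure (lebesgue_on \<Omega>)"
  using lmeasurable_domain by (simp add: finite_measure_lebesgue_on)

lemma L2_space_continuous:
  fixes f :: "point \<Rightarrow> 'b::euclidean_space"
  assumes "continuous_on (closure \<Omega>) f"
  shows "f \<in> L2_space (lebesgue_on \<Omega>)"
proof -
  have "compact (f ` closure \<Omega>)"
    using assms bounded_domain by (intro compact_continuous_image) (auto simp: compact_closure)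
  then obtain B where B: "\<And>x. x \<in> closure \<Omega> \<Longrightarrow> norm (f x) \<le> B"
    by (fastforce dest: compact_imp_bounded simp: bounded_iff)
  have [measurable]: "f \<in> borel_measurable (lebesgue_on \<Omega>)"
    using assms continuous_on_subset closure_subset
    by (intro continuous_imp_measurable_on_sets_lebesgue sets_domain) blast
  have "integrable (lebesgue_on \<Omega>) (\<lambda>x. (norm (f x))\<^sup>2)"
  proof (rule finite_measure.integrable_const_bound[OF finite_measure_domain, where B = "B\<^sup>2"])
    show "AE x in lebesgue_on \<Omega>. norm ((norm (f x))\<^sup>2) \<le> B\<^sup>2"
      using B closure_subset by (intro AE_I2) (auto intro!: power_mono)
  qed measurable
  then show ?thesis by (simp add: L2_space_def)
qed

text \<open>The function is paired with the constant 1, which is square-integrable because \<Omega>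
  is bounded.\<close>

lemma L2_space_integrable:
  fixes h :: "point \<Rightarrow> real"
  assumes "h \<in> L2_space (lebesgue_on \<Omega>)"
  shows "integrable (lebesgue_on \<Omega>) h"
  using L2_space_integrable_inner[OF assms L2_space_continuous[of "\<lambda>_. 1"]] by simp

lemma test_function_L2:
  assumes "test_function \<Omega> \<phi>"
  shows "\<phi> \<in> L2_space (lebesgue_on \<Omega>)"
    and "(\<lambda>x. frechet_derivative \<phi> (at x) (axis j 1)) \<in> L2_space (lebesgue_on \<Omega>)"
proof -
  have smooth: "Ck_on k UNIV \<phi>" for k
    using assms by (simp add: test_function_def smooth_on_def)
  show "\<phi> \<in> L2_space (lebesgue_on \<Omega>)"
    using smooth[of 0] by (intro L2_space_continuous) (auto intro: continuous_on_subset)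
  have "continuous_on UNIV (\<lambda>x. frechet_derivative \<phi> (at x) (axis j 1))"
    using smooth[of "Suc 0"] by (simp add: axis_in_Basis_iff)
  then show "(\<lambda>x. frechet_derivative \<phi> (at x) (axis j 1)) \<in> L2_space (lebesgue_on \<Omega>)"
    by (intro L2_space_continuous) (auto intro: continuous_on_subset)
qed

lemma has_weak_gradient_lincomb:
  assumes "u \<in> L2_space (lebesgue_on \<Omega>)" "v \<in> L2_space (lebesgue_on \<Omega>)"
    and "G \<in> L2_space (lebesgue_on \<Omega>)" "H \<in> L2_space (lebesgue_on \<Omega>)"
    and "has_weak_gradient \<Omega> u G" "has_weak_gradient \<Omega> v H"
    and w: "\<And>x. x \<in> \<Omega> \<Longrightarrow> w x = c * u x + d * v x"
  shows "has_weak_gradient \<Omega> w (\<lambda>x. c *\<^sub>R G x + d *\<^sub>R H x)"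
  unfolding has_weak_gradient_def
proof (intro allI impI)
  fix \<phi> and j :: 3 assume \<phi>: "test_function \<Omega> \<phi>"
  let ?D = "\<lambda>x. frechet_derivative \<phi> (at x) (axis j 1)"
  have comp: "(\<lambda>x. F x $ j) \<in> L2_space (lebesgue_on \<Omega>)" if "F \<in> L2_space (lebesgue_on \<Omega>)"
    for F :: field
    using L2_space_bounded_linear[OF bounded_linear_vec_nth that] .
  have int: "integrable (lebesgue_on \<Omega>) (\<lambda>x. u x * ?D x)" "integrable (lebesgue_on \<Omega>) (\<lambda>x. v x * ?D x)"
      "integrable (lebesgue_on \<Omega>) (\<lambda>x. G x $ j * \<phi> x)" "integrable (lebesgue_on \<Omega>) (\<lambda>x. H x $ j * \<phi> x)"
    using L2_space_integrable_inner[OF assms(1) test_function_L2(2)[OF \<phi>]]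
      L2_space_integrable_inner[OF assms(2) test_function_L2(2)[OF \<phi>]]
      L2_space_integrable_inner[OF comp[OF assms(3)] test_function_L2(1)[OF \<phi>]]
      L2_space_integrable_inner[OF comp[OF assms(4)] test_function_L2(1)[OF \<phi>]]
    by simp_all
  have "(\<integral>x. w x * ?D x \<partial>lebesgue_on \<Omega>) = (\<integral>x. c * (u x * ?D x) + d * (v x * ?D x) \<partial>lebesgue_on \<Omega>)"
    by (rule Bochner_Integration.integral_cong) (auto simp: w algebra_simps)
  also have "\<dots> = c * (\<integral>x. u x * ?D x \<partial>lebesgue_on \<Omega>) + d * (\<integral>x. v x * ?D x \<partial>lebesgue_on \<Omega>)"
    using int by simp
  also have "\<dots> = - (c * (\<integral>x. G x $ j * \<phi> x \<partial>lebesgue_on \<Omega>) + d * (\<integral>x. H x $ j * \<phi> x \<partial>lebesgue_on \<Omega>))"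
    using assms(5,6) \<phi> by (simp add: has_weak_gradient_def)
  also have "\<dots> = - (\<integral>x. c * (G x $ j * \<phi> x) + d * (H x $ j * \<phi> x) \<partial>lebesgue_on \<Omega>)"
    using int by simp
  also have "\<dots> = - (\<integral>x. (c *\<^sub>R G x + d *\<^sub>R H x) $ j * \<phi> x \<partial>lebesgue_on \<Omega>)"
    by (simp add: algebra_simps)
  finally show "(\<integral>x. w x * ?D x \<partial>lebesgue_on \<Omega>) =
      - (\<integral>x. (c *\<^sub>R G x + d *\<^sub>R H x) $ j * \<phi> x \<partial>lebesgue_on \<Omega>)" .
qed

text \<open>The two defining identities share their left side, so each component of the difference
  is orthogonal to every test function and the fundamental lemma applies.\<close>

lemma weak_gradient_unique:
  assumes G: "G \<in> L2_space (lebesgue_on \<Omega>)" "has_weak_gradient \<Omega> w G"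
    and H: "H \<in> L2_space (lebesgue_on \<Omega>)" "has_weak_gradient \<Omega> w H"
  shows "AE x in lebesgue_on \<Omega>. G x = H x"
proof -
  have comp: "(\<lambda>x. F x $ j) \<in> L2_space (lebesgue_on \<Omega>)" if "F \<in> L2_space (lebesgue_on \<Omega>)"
    for F :: field and j
    using L2_space_bounded_linear[OF bounded_linear_vec_nth that] .
  have "AE x in lebesgue_on \<Omega>. G x $ j - H x $ j = 0" for j
  proof (rule fundamental_lemma_calculus_of_variations[OF open_domain])
    show "integrable (lebesgue_on \<Omega>) (\<lambda>x. G x $ j - H x $ j)"
      using comp[OF G(1)] comp[OF H(1)] L2_space_integrable by simp
    fix \<phi> assume \<phi>: "test_function \<Omega> \<phi>"
    have "integrable (lebesgue_on \<Omega>) (\<lambda>x. G x $ j * \<phi> x)" "integrable (lebesgue_on \<Omega>) (\<lambda>x. H x $ j * \<phi> x)"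
      using L2_space_integrable_inner[OF comp[OF G(1)] test_function_L2(1)[OF \<phi>]]
        L2_space_integrable_inner[OF comp[OF H(1)] test_function_L2(1)[OF \<phi>]]
      by simp_all
    then have "(\<integral>x. (G x $ j - H x $ j) * \<phi> x \<partial>lebesgue_on \<Omega>) =
        (\<integral>x. G x $ j * \<phi> x \<partial>lebesgue_on \<Omega>) - (\<integral>x. H x $ j * \<phi> x \<partial>lebesgue_on \<Omega>)"
      by (simp add: algebra_simps)
    also have "\<dots> = 0"
      using G(2) H(2) \<phi> by (auto simp: has_weak_gradient_def)
    finally show "(\<integral>x. (G x $ j - H x $ j) * \<phi> x \<partial>lebesgue_on \<Omega>) = 0" .
  qed
  then have "AE x in lebesgue_on \<Omega>. \<forall>j. G x $ j - H x $ j = 0"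
    by (simp add: AE_all_countable)
  then show ?thesis
    by eventually_elim (simp add: vec_eq_iff)
qed

lemma weak_gradient:
  assumes "w \<in> H1_space \<Omega>"
  shows "weak_gradient \<Omega> w \<in> L2_space (lebesgue_on \<Omega>)" "has_weak_gradient \<Omega> w (weak_gradient \<Omega> w)"
proof -
  have "\<exists>G. G \<in> L2_space (lebesgue_on \<Omega>) \<and> has_weak_gradient \<Omega> w G"
    using assms by (auto simp: H1_space_def)
  from someI_ex[OF this] show "weak_gradient \<Omega> w \<in> L2_space (lebesgue_on \<Omega>)"
      "has_weak_gradient \<Omega> w (weak_gradient \<Omega> w)"
    by (simp_all add: weak_gradient_def)
qed

text \<open>\<open>weak_gradient\<close> picks an arbitrary representative and need not be linear
  pointwise. The combination of the chosen gradients is some weak gradient of \<open>w\<close>, and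
  uniqueness identifies it with the chosen one off a null set.\<close>

lemma H1_space_lincomb:
  assumes u: "u \<in> H1_space \<Omega>" and v: "v \<in> H1_space \<Omega>"
    and w: "\<And>x. x \<in> \<Omega> \<Longrightarrow> w x = c * u x + d * v x"
  shows "w \<in> H1_space \<Omega>"
    and "AE x in lebesgue_on \<Omega>. weak_gradient \<Omega> w x = c *\<^sub>R weak_gradient \<Omega> u x + d *\<^sub>R weak_gradient \<Omega> v x"
proof -
  let ?G = "\<lambda>x. c *\<^sub>R weak_gradient \<Omega> u x + d *\<^sub>R weak_gradient \<Omega> v x"
  have L2: "u \<in> L2_space (lebesgue_on \<Omega>)" "v \<in> L2_space (lebesgue_on \<Omega>)"
    using u v by (auto simp: H1_space_def)
  have G: "?G \<in> L2_space (lebesgue_on \<Omega>)" "has_weak_gradient \<Omega> w ?G"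
    by (intro L2_space_lincomb has_weak_gradient_lincomb[OF L2 _ _ _ _ w] weak_gradient u v;
        assumption)+
  have "w \<in> L2_space (lebesgue_on \<Omega>)"
    using L2_space_lincomb[OF L2, of c d] by (rule L2_space_cong) (simp add: w)
  with G show H1: "w \<in> H1_space \<Omega>"
    by (auto simp: H1_space_def)
  show "AE x in lebesgue_on \<Omega>. weak_gradient \<Omega> w x = ?G x"
    using weak_gradient[OF H1] G by (rule weak_gradient_unique)
qed

lemma H1_fields_lincomb:
  assumes "u \<in> H1_fields \<Omega>" "v \<in> H1_fields \<Omega>"
    and "\<And>x. x \<in> \<Omega> \<Longrightarrow> w x = c *\<^sub>R u x + d *\<^sub>R v x"
  shows "w \<in> H1_fields \<Omega>"
    and "AE x in lebesgue_on \<Omega>. grad \<Omega> w x = c *\<^sub>R grad \<Omega> u x + d *\<^sub>R grad \<Omega> v x"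
proof -
  have *: "(\<lambda>x. w x $ i) \<in> H1_space \<Omega>"
    "AE x in lebesgue_on \<Omega>. weak_gradient \<Omega> (\<lambda>x. w x $ i) x =
      c *\<^sub>R weak_gradient \<Omega> (\<lambda>x. u x $ i) x + d *\<^sub>R weak_gradient \<Omega> (\<lambda>x. v x $ i) x" for i
    using H1_space_lincomb[of "\<lambda>x. u x $ i" "\<lambda>x. v x $ i" "\<lambda>x. w x $ i" c d] assms
    by (simp_all add: H1_fields_def)
  then show "w \<in> H1_fields \<Omega>"
    by (simp add: H1_fields_def)
  have "AE x in lebesgue_on \<Omega>. \<forall>i. weak_gradient \<Omega> (\<lambda>x. w x $ i) x =
      c *\<^sub>R weak_gradient \<Omega> (\<lambda>x. u x $ i) x + d *\<^sub>R weak_gradient \<Omega> (\<lambda>x. v x $ i) x"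
    using *(2) by (simp add: AE_all_countable)
  then show "AE x in lebesgue_on \<Omega>. grad \<Omega> w x = c *\<^sub>R grad \<Omega> u x + d *\<^sub>R grad \<Omega> v x"
    by eventually_elim (simp add: grad_def vec_eq_iff)
qed

end

subsection \<open>Bilinear forms and the finite element space\<close>

text \<open>The function \<open>w\<close> ranges over everything that agrees on \<open>X\<close>
  with the combination. The notion thus contains linearity together with independence of the values
  off \<open>X\<close>, which the encoding of fields as total functions leaves arbitrary.\<close>

definition linear_on :: "point set \<Rightarrow> field set \<Rightarrow> (field \<Rightarrow> real) \<Rightarrow> bool" where
  "linear_on X S F \<longleftrightarrow> (\<forall>u\<in>S. \<forall>v\<in>S. \<forall>c d w.
     (\<forall>x\<in>X. w x = c *\<^sub>R u x + d *\<^sub>R v x) \<longrightarrow> F w = c * F u + d * F v)"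

definition bilinear_on :: "point set \<Rightarrow> field set \<Rightarrow> (field \<Rightarrow> field \<Rightarrow> real) \<Rightarrow> bool" where
  "bilinear_on X S b \<longleftrightarrow> (\<forall>z\<in>S. linear_on X S (\<lambda>u. b u z) \<and> linear_on X S (b z))"

text \<open>With \<open>c = 1\<close> and \<open>d = 0\<close> this includes closure under changing
  a member off \<open>X\<close>.\<close>

definition subspace_on :: "point set \<Rightarrow> field set \<Rightarrow> bool" where
  "subspace_on X S \<longleftrightarrow> (\<forall>u\<in>S. \<forall>v\<in>S. \<forall>c d w.
     (\<forall>x\<in>X. w x = c *\<^sub>R u x + d *\<^sub>R v x) \<longrightarrow> w \<in> S)"

lemma linear_onD:
  "linear_on X S F \<Longrightarrow> u \<in> S \<Longrightarrow> v \<in> S \<Longrightarrow> (\<And>x. x \<in> X \<Longrightarrow> w x = c *\<^sub>R u x + d *\<^sub>R v x)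
    \<Longrightarrow> F w = c * F u + d * F v"
  unfolding linear_on_def by blast

lemma subspace_onD:
  "subspace_on X S \<Longrightarrow> u \<in> S \<Longrightarrow> v \<in> S \<Longrightarrow> (\<And>x. x \<in> X \<Longrightarrow> w x = c *\<^sub>R u x + d *\<^sub>R v x) \<Longrightarrow> w \<in> S"
  unfolding subspace_on_def by blast

lemma bilinear_onD:
  assumes "bilinear_on X S b" "z \<in> S"
  shows "linear_on X S (\<lambda>u. b u z)" "linear_on X S (b z)"
  using assms by (auto simp: bilinear_on_def)

text \<open>A larger \<open>X\<close> makes the premise on \<open>w\<close> stronger. This is how
  statements about \<Omega>, natural for integrals, become statements about
  \<open>closure \<Omega>\<close>, natural for continuous fields.\<close>

lemma linear_on_mono:
  assumes "linear_on X S F" "S' \<subseteq> S" "X \<subseteq> X'"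
  shows "linear_on X' S' F"
  unfolding linear_on_def
proof (intro ballI allI impI)
  fix u v c d w
  assume "u \<in> S'" "v \<in> S'" "\<forall>x\<in>X'. w x = c *\<^sub>R u x + d *\<^sub>R v x"
  with assms(2,3) show "F w = c * F u + d * F v"
    by (intro linear_onD[OF assms(1)]) auto
qed

lemma bilinear_on_mono:
  assumes "bilinear_on X S b" "S' \<subseteq> S" "X \<subseteq> X'"
  shows "bilinear_on X' S' b"
  using assms linear_on_mono[OF _ assms(2,3)] unfolding bilinear_on_def by blast

lemma L2_space_sum:
  assumes "finite A" "A \<noteq> {}" "\<And>i. i \<in> A \<Longrightarrow> f i \<in> L2_space N"
  shows "(\<lambda>x. \<Sum>i\<in>A. f i x) \<in> L2_space N"
  using assms
proof (induction A rule: finite_ne_induct)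
  case (insert i A)
  then have "(\<lambda>x. 1 *\<^sub>R f i x + 1 *\<^sub>R (\<Sum>i\<in>A. f i x)) \<in> L2_space N"
    by (intro L2_space_lincomb) auto
  with insert show ?case by simp
qed simp

lemma bounded_linear_axis: "bounded_linear (axis i :: 'a::euclidean_space \<Rightarrow> 'a^'n)"
  by (intro linear_conv_bounded_linear[THEN iffD1] linearI)
     (auto simp: axis_def vec_eq_iff)

definition symmetric_part :: "real^3^3 \<Rightarrow> real^3^3" where
  "symmetric_part G = (1/2) *\<^sub>R (G + transpose G)"

lemma linear_symmetric_part: "linear symmetric_part"
  by (intro linearI) (auto simp: symmetric_part_def transpose_def vec_eq_iff algebra_simps)

lemma linear_trace: "linear (trace :: real^3^3 \<Rightarrow> real)"
  by (intro linearI) (auto simp: trace_def sum.distrib sum_distrib_left)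

lemma linear_add_trace: "linear (\<lambda>G :: real^3^3. a *\<^sub>R G + (b * trace G) *\<^sub>R mat 1)"
  by (intro linearI) (auto simp: linear_add[OF linear_trace] linear_cmul[OF linear_trace] algebra_simps)

text \<open>One family covers all tensors that occur: (\<open>a\<close>, \<open>b\<close>) is (1, 0)
  for the strain, (1, -1/3) for its deviator, (2 \<mu>, \<open>lam\<close>) for the elastic stress
  and (\<kappa>, -\<kappa>/3) for the viscoelastic one.\<close>

lemma bounded_linear_stress:
  "bounded_linear (\<lambda>G. a *\<^sub>R symmetric_part G + (b * trace (symmetric_part G)) *\<^sub>R mat 1)"
  using linear_compose[OF linear_symmetric_part linear_add_trace[of a b]]
  by (simp add: o_def linear_conv_bounded_linear)

lemma strain_eq: "strain \<Omega> w x = symmetric_part (grad \<Omega> w x)"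
  by (simp add: strain_def symmetric_part_def)

context bounded_open_domain
begin

lemma grad_L2:
  assumes "v \<in> H1_fields \<Omega>"
  shows "grad \<Omega> v \<in> L2_space (lebesgue_on \<Omega>)"
proof -
  have "(\<lambda>x. axis i (weak_gradient \<Omega> (\<lambda>y. v y $ i) x)) \<in> L2_space (lebesgue_on \<Omega>)" for i
    using assms by (intro L2_space_bounded_linear[OF bounded_linear_axis weak_gradient(1)]) (auto simp: H1_fields_def)
  then have "(\<lambda>x. \<Sum>i\<in>UNIV. axis i (weak_gradient \<Omega> (\<lambda>y. v y $ i) x)) \<in> L2_space (lebesgue_on \<Omega>)"
    by (intro L2_space_sum) auto
  then show ?thesis
  proof (rule L2_space_cong)
    show "(\<Sum>i\<in>UNIV. axis i (weak_gradient \<Omega> (\<lambda>y. v y $ i) x)) = grad \<Omega> v x" for x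
      by (simp add: grad_def vec_eq_iff axis_def if_distrib[of "\<lambda>y. y $ _"] cong: if_cong)
  qed
qed

text \<open>The gradient is linear only almost everywhere, but the integral does not see null sets,
  so the form is exactly bilinear.\<close>

lemma bilinear_gradient_form:
  assumes P: "bounded_linear P" and Q: "bounded_linear Q"
  shows "bilinear_on \<Omega> (H1_fields \<Omega>)
    (\<lambda>u v. L2_inner (lebesgue_on \<Omega>) (\<lambda>x. P (grad \<Omega> u x)) (\<lambda>x. Q (grad \<Omega> v x)))"
proof -
  have L2: "(\<lambda>x. R (grad \<Omega> u x)) \<in> L2_space (lebesgue_on \<Omega>)"
    if "bounded_linear R" "u \<in> H1_fields \<Omega>" for R :: "real^3^3 \<Rightarrow> 'b::euclidean_space" and u
    using L2_space_bounded_linear[OF that(1) grad_L2[OF that(2)]] .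
  have AE: "AE x in lebesgue_on \<Omega>. R (grad \<Omega> w x) = c *\<^sub>R R (grad \<Omega> u x) + d *\<^sub>R R (grad \<Omega> v x)"
    if R: "bounded_linear R" and uv: "u \<in> H1_fields \<Omega>" "v \<in> H1_fields \<Omega>"
      and w: "\<forall>x\<in>\<Omega>. w x = c *\<^sub>R u x + d *\<^sub>R v x"
    for R :: "real^3^3 \<Rightarrow> 'b::euclidean_space" and u v w c d
  proof -
    have "linear R"
      using R by (rule bounded_linear.linear)
    moreover have "AE x in lebesgue_on \<Omega>. grad \<Omega> w x = c *\<^sub>R grad \<Omega> u x + d *\<^sub>R grad \<Omega> v x"
      using H1_fields_lincomb(2)[OF uv] w by blast
    ultimately show ?thesis
      by (auto elim!: eventually_mono simp: linear_add linear_cmul)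
  qed
  show ?thesis
    unfolding bilinear_on_def linear_on_def
  proof (intro ballI allI impI conjI)
    fix z u v c d w
    assume *: "z \<in> H1_fields \<Omega>" "u \<in> H1_fields \<Omega>" "v \<in> H1_fields \<Omega>"
      and w: "\<forall>x\<in>\<Omega>. w x = c *\<^sub>R u x + d *\<^sub>R v x"
    then have wH: "w \<in> H1_fields \<Omega>"
      using H1_fields_lincomb(1) by blast
    show "L2_inner (lebesgue_on \<Omega>) (\<lambda>x. P (grad \<Omega> w x)) (\<lambda>x. Q (grad \<Omega> z x)) =
        c * L2_inner (lebesgue_on \<Omega>) (\<lambda>x. P (grad \<Omega> u x)) (\<lambda>x. Q (grad \<Omega> z x)) +
        d * L2_inner (lebesgue_on \<Omega>) (\<lambda>x. P (grad \<Omega> v x)) (\<lambda>x. Q (grad \<Omega> z x))"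
      using L2[OF P wH]
      by (intro L2_inner_lincomb_left[OF L2[OF P *(2)] L2[OF P *(3)] L2[OF Q *(1)] _ AE[OF P *(2,3) w]])
         (simp add: L2_space_def)
    show "L2_inner (lebesgue_on \<Omega>) (\<lambda>x. P (grad \<Omega> z x)) (\<lambda>x. Q (grad \<Omega> w x)) =
        c * L2_inner (lebesgue_on \<Omega>) (\<lambda>x. P (grad \<Omega> z x)) (\<lambda>x. Q (grad \<Omega> u x)) +
        d * L2_inner (lebesgue_on \<Omega>) (\<lambda>x. P (grad \<Omega> z x)) (\<lambda>x. Q (grad \<Omega> v x))"
      using L2[OF Q wH]
      by (intro L2_inner_lincomb_right[OF L2[OF Q *(2)] L2[OF Q *(3)] L2[OF P *(1)] _ AE[OF Q *(2,3) w]])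
         (simp add: L2_space_def)
  qed
qed

lemma bilinear_a_E: "bilinear_on \<Omega> (H1_fields \<Omega>) (a_E \<Omega> \<mu> lam)"
proof -
  have "a_E \<Omega> \<mu> lam = (\<lambda>u v. L2_inner (lebesgue_on \<Omega>)
      (\<lambda>x. (2 * \<mu>) *\<^sub>R symmetric_part (grad \<Omega> u x) + (lam * trace (symmetric_part (grad \<Omega> u x))) *\<^sub>R mat 1)
      (\<lambda>x. 1 *\<^sub>R symmetric_part (grad \<Omega> v x) + (0 * trace (symmetric_part (grad \<Omega> v x))) *\<^sub>R mat 1))"
    by (simp add: fun_eq_iff a_E_def stress_E_def[abs_def] strain_eq[abs_def])
  then show ?thesis
    by (simp only: bilinear_gradient_form[OF bounded_linear_stress bounded_linear_stress])
qed

lemma bilinear_a_VE: "bilinear_on \<Omega> (H1_fields \<Omega>) (a_VE \<Omega> \<kappa>)"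
proof -
  have "a_VE \<Omega> \<kappa> = (\<lambda>u v. L2_inner (lebesgue_on \<Omega>)
      (\<lambda>x. \<kappa> *\<^sub>R symmetric_part (grad \<Omega> u x) + (- (\<kappa> / 3) * trace (symmetric_part (grad \<Omega> u x))) *\<^sub>R mat 1)
      (\<lambda>x. 1 *\<^sub>R symmetric_part (grad \<Omega> v x) + (- (1/3) * trace (symmetric_part (grad \<Omega> v x))) *\<^sub>R mat 1))"
    by (simp add: fun_eq_iff a_VE_def stress_VE_def[abs_def] dev_strain_def[abs_def] strain_eq[abs_def] algebra_simps)
  then show ?thesis
    by (simp only: bilinear_gradient_form[OF bounded_linear_stress bounded_linear_stress])
qed

lemma a_VE_nonneg: "0 \<le> \<kappa> \<Longrightarrow> 0 \<le> a_VE \<Omega> \<kappa> u u"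
  unfolding a_VE_def L2_inner_def stress_VE_def by (intro integral_nonneg_AE) auto

lemma bilinear_L2:
  assumes "S \<subseteq> L2_space (lebesgue_on \<Omega>)"
  shows "bilinear_on \<Omega> S (\<lambda>u v. L2_inner (lebesgue_on \<Omega>) (\<lambda>x. \<rho> *\<^sub>R u x) v)"
proof -
  have cong: "L2_inner (lebesgue_on \<Omega>) f g = L2_inner (lebesgue_on \<Omega>) f' g'"
    if "\<And>x. x \<in> \<Omega> \<Longrightarrow> f x = f' x" "\<And>x. x \<in> \<Omega> \<Longrightarrow> g x = g' x" for f g f' g' :: field
    unfolding L2_inner_def by (rule Bochner_Integration.integral_cong) (auto simp: that)
  have scale: "(\<lambda>x. \<rho> *\<^sub>R u x) \<in> L2_space (lebesgue_on \<Omega>)" if "u \<in> S" for u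
    using L2_space_bounded_linear[OF bounded_linear_scaleR_right] assms that by blast
  show ?thesis
    unfolding bilinear_on_def linear_on_def
  proof (intro ballI allI impI conjI)
    fix z u v c d w
    assume *: "z \<in> S" "u \<in> S" "v \<in> S" and w: "\<forall>x\<in>\<Omega>. w x = c *\<^sub>R u x + d *\<^sub>R v x"
    then have L2: "z \<in> L2_space (lebesgue_on \<Omega>)" "u \<in> L2_space (lebesgue_on \<Omega>)" "v \<in> L2_space (lebesgue_on \<Omega>)"
      using assms by auto
    have wL2: "(\<lambda>x. c *\<^sub>R u x + d *\<^sub>R v x) \<in> L2_space (lebesgue_on \<Omega>)"
      "(\<lambda>x. c *\<^sub>R (\<rho> *\<^sub>R u x) + d *\<^sub>R (\<rho> *\<^sub>R v x)) \<in> L2_space (lebesgue_on \<Omega>)"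
      using L2_space_lincomb[OF L2(2,3)] L2_space_lincomb[OF scale[OF *(2)] scale[OF *(3)]] .
    have "L2_inner (lebesgue_on \<Omega>) (\<lambda>x. \<rho> *\<^sub>R w x) z =
        L2_inner (lebesgue_on \<Omega>) (\<lambda>x. c *\<^sub>R (\<rho> *\<^sub>R u x) + d *\<^sub>R (\<rho> *\<^sub>R v x)) z"
      by (rule cong) (auto simp: w algebra_simps)
    also have "\<dots> = c * L2_inner (lebesgue_on \<Omega>) (\<lambda>x. \<rho> *\<^sub>R u x) z
        + d * L2_inner (lebesgue_on \<Omega>) (\<lambda>x. \<rho> *\<^sub>R v x) z"
      using wL2 by (intro L2_inner_lincomb_left[OF scale[OF *(2)] scale[OF *(3)] L2(1)]) (auto simp: L2_space_def)
    finally show "L2_inner (lebesgue_on \<Omega>) (\<lambda>x. \<rho> *\<^sub>R w x) z = c * L2_inner (lebesgue_on \<Omega>) (\<lambda>x. \<rho> *\<^sub>R u x) z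
        + d * L2_inner (lebesgue_on \<Omega>) (\<lambda>x. \<rho> *\<^sub>R v x) z" .
    have "L2_inner (lebesgue_on \<Omega>) (\<lambda>x. \<rho> *\<^sub>R z x) w =
        L2_inner (lebesgue_on \<Omega>) (\<lambda>x. \<rho> *\<^sub>R z x) (\<lambda>x. c *\<^sub>R u x + d *\<^sub>R v x)"
      by (rule cong) (auto simp: w algebra_simps)
    also have "\<dots> = c * L2_inner (lebesgue_on \<Omega>) (\<lambda>x. \<rho> *\<^sub>R z x) u
        + d * L2_inner (lebesgue_on \<Omega>) (\<lambda>x. \<rho> *\<^sub>R z x) v"
      using wL2 by (intro L2_inner_lincomb_right[OF L2(2,3) scale[OF *(1)]]) (auto simp: L2_space_def)
    finally show "L2_inner (lebesgue_on \<Omega>) (\<lambda>x. \<rho> *\<^sub>R z x) w = c * L2_inner (lebesgue_on \<Omega>) (\<lambda>x. \<rho> *\<^sub>R z x) u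
        + d * L2_inner (lebesgue_on \<Omega>) (\<lambda>x. \<rho> *\<^sub>R z x) v" .
  qed
qed

end

section \<open>Stability of the zero trace condition under linear combinations\<close>

lemma smooth_on_lincomb:
  assumes "smooth_on UNIV f" "smooth_on UNIV g"
  shows "smooth_on UNIV (\<lambda>x. c *\<^sub>R f x + d *\<^sub>R g x)"
proof -
  have "Ck_on k UNIV (\<lambda>x. c *\<^sub>R f x + d *\<^sub>R g x)" if "Ck_on k UNIV f" "Ck_on k UNIV g" for k
    using that
  proof (induction k arbitrary: f g)
    case 0
    then show ?case by (auto intro!: continuous_intros)
  next
    case (Suc k)
    then have diff: "f differentiable at x" "g differentiable at x" for x
      by (auto simp: differentiable_on_def)
    have "frechet_derivative (\<lambda>x. c *\<^sub>R f x + d *\<^sub>R g x) (at x) =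
        (\<lambda>i. c *\<^sub>R frechet_derivative f (at x) i + d *\<^sub>R frechet_derivative g (at x) i)" for x
      by (rule frechet_derivative_at[symmetric])
         (auto intro!: derivative_eq_intros diff[THEN frechet_derivative_works[THEN iffD1]])
    with Suc diff show ?case
      by (auto simp: differentiable_on_def intro!: derivative_intros)
  qed
  with assms show ?thesis by (auto simp: smooth_on_def)
qed

lemma smooth_on_differentiable: "smooth_on UNIV f \<Longrightarrow> f differentiable at x"
  unfolding smooth_on_def using Ck_on.simps(2)[of 0 UNIV f]
  by (auto simp del: Ck_on.simps simp: differentiable_on_def)

lemma smooth_on_continuous:
  assumes "smooth_on UNIV f"
  shows "continuous_on UNIV f"
  using assms unfolding smooth_on_def by (metis Ck_on.simps(1))

lemma smooth_on_continuous_matrix_derivative: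
  fixes f :: field
  assumes "smooth_on UNIV f"
  shows "continuous_on UNIV (\<lambda>x. matrix (frechet_derivative f (at x)))"
proof -
  have "Ck_on (Suc 0) UNIV f"
    using assms unfolding smooth_on_def by blast
  then have "continuous_on UNIV (\<lambda>x. frechet_derivative f (at x) (axis j 1))" for j
    by simp
  then show ?thesis
    unfolding matrix_def by (intro continuous_intros)
qed

text \<open>The pointwise bound \<open>norm_lincomb_square_le\<close> replaces the triangle
  inequality of the norm. It works directly with extended nonnegative integrals, which may be
  infinite for early indices.\<close>

lemma nn_integral_square_lincomb_tendsto_0:
  fixes a b h :: "nat \<Rightarrow> 'a \<Rightarrow> 'b::euclidean_space"
  assumes a: "\<And>j. a j \<in> borel_measurable N" "(\<lambda>j. \<integral>\<^sup>+x. ennreal ((norm (a j x))\<^sup>2) \<partial>N) \<longlonglongrightarrow> 0"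
    and b: "\<And>j. b j \<in> borel_measurable N" "(\<lambda>j. \<integral>\<^sup>+x. ennreal ((norm (b j x))\<^sup>2) \<partial>N) \<longlonglongrightarrow> 0"
    and h: "\<And>j. AE x in N. h j x = c *\<^sub>R a j x + d *\<^sub>R b j x"
  shows "(\<lambda>j. \<integral>\<^sup>+x. ennreal ((norm (h j x))\<^sup>2) \<partial>N) \<longlonglongrightarrow> 0"
proof -
  note [measurable] = a(1) b(1)
  let ?B = "\<lambda>j. ennreal (2 * c\<^sup>2) * (\<integral>\<^sup>+x. ennreal ((norm (a j x))\<^sup>2) \<partial>N)
      + ennreal (2 * d\<^sup>2) * (\<integral>\<^sup>+x. ennreal ((norm (b j x))\<^sup>2) \<partial>N)"
  have le: "(\<integral>\<^sup>+x. ennreal ((norm (h j x))\<^sup>2) \<partial>N) \<le> ?B j" for j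
  proof -
    have "(\<integral>\<^sup>+x. ennreal ((norm (h j x))\<^sup>2) \<partial>N)
        \<le> (\<integral>\<^sup>+x. ennreal (2 * c\<^sup>2) * ennreal ((norm (a j x))\<^sup>2)
            + ennreal (2 * d\<^sup>2) * ennreal ((norm (b j x))\<^sup>2) \<partial>N)"
      using h[of j]
      by (intro nn_integral_mono_AE)
         (auto elim!: eventually_mono intro!: ennreal_leI norm_lincomb_square_le
           simp: ennreal_mult[symmetric] ennreal_plus[symmetric] simp del: ennreal_plus)
    also have "\<dots> = ?B j"
      by (simp add: nn_integral_add nn_integral_cmult)
    finally show ?thesis .
  qed
  have "?B \<longlonglongrightarrow> ennreal (2 * c\<^sup>2) * 0 + ennreal (2 * d\<^sup>2) * 0"
    by (intro tendsto_add ennreal_tendsto_cmult a(2) b(2)) auto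
  then have "?B \<longlonglongrightarrow> 0" by simp
  then show ?thesis
    by (rule tendsto_sandwich[OF always_eventually always_eventually tendsto_const, rotated 2])
       (auto intro: le)
qed

lemma borel_measurable_area:
  fixes f :: "point \<Rightarrow> 'b::euclidean_space"
  assumes "continuous_on UNIV f"
  shows "f \<in> borel_measurable (restrict_space area_measure \<Gamma>)"
proof -
  have "sets area_measure = sets borel"
    unfolding area_measure_def using sets.sigma_sets_eq[of borel] by (subst sets_measure_of) auto
  then have "borel_measurable area_measure = (borel_measurable borel :: (point \<Rightarrow> 'b) set)"
    by (rule measurable_cong_sets) simp
  then show ?thesis
    using assms by (intro measurable_restrict_space1) (simp add: borel_measurable_continuous_onI)
qed

context bounded_open_domain
begin

lemma H1_fields_L2:
  assumes "v \<in> H1_fields \<Omega>"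
  shows "v \<in> L2_space (lebesgue_on \<Omega>)"
proof -
  have "(\<lambda>x. axis i (v x $ i)) \<in> L2_space (lebesgue_on \<Omega>)" for i
    using assms
    by (intro L2_space_bounded_linear[OF bounded_linear_axis, of "\<lambda>x. v x $ i"])
       (auto simp: H1_fields_def H1_space_def)
  then have "(\<lambda>x. \<Sum>i\<in>UNIV. axis i (v x $ i)) \<in> L2_space (lebesgue_on \<Omega>)"
    by (intro L2_space_sum) auto
  then show ?thesis
  proof (rule L2_space_cong)
    show "(\<Sum>i\<in>UNIV. axis i (v x $ i)) = v x" for x
      by (simp add: vec_eq_iff axis_def if_distrib[of "\<lambda>y. y $ _"] cong: if_cong)
  qed
qed

lemma borel_measurable_lebesgue_on:
  fixes f :: "point \<Rightarrow> 'b::euclidean_space"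
  assumes "continuous_on UNIV f"
  shows "f \<in> borel_measurable (lebesgue_on \<Omega>)"
  using assms by (intro continuous_imp_measurable_on_sets_lebesgue sets_domain) (auto intro: continuous_on_subset)

text \<open>The same combination of two approximating sequences serves for \<open>w\<close>. In the
  gradient part, \<open>grad \<Omega> w\<close> is the combination of the gradients only off a null
  set.\<close>

lemma zero_trace_on_lincomb:
  assumes uv: "u \<in> H1_fields \<Omega>" "v \<in> H1_fields \<Omega>" "zero_trace_on \<Omega> \<Gamma> u" "zero_trace_on \<Omega> \<Gamma> v"
    and w: "\<And>x. x \<in> \<Omega> \<Longrightarrow> w x = c *\<^sub>R u x + d *\<^sub>R v x"
  shows "zero_trace_on \<Omega> \<Gamma> w"
proof -
  obtain \<phi> where \<phi>: "\<And>j::nat. smooth_on UNIV (\<phi> j :: field)"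
    "(\<lambda>j. \<integral>\<^sup>+x. ennreal ((norm (\<phi> j x - u x))\<^sup>2) \<partial>lebesgue_on \<Omega>) \<longlonglongrightarrow> 0"
    "(\<lambda>j. \<integral>\<^sup>+x. ennreal ((norm (matrix (frechet_derivative (\<phi> j) (at x)) - grad \<Omega> u x))\<^sup>2)
           \<partial>lebesgue_on \<Omega>) \<longlonglongrightarrow> 0"
    "(\<lambda>j. \<integral>\<^sup>+x. ennreal ((norm (\<phi> j x))\<^sup>2) \<partial>restrict_space area_measure \<Gamma>) \<longlonglongrightarrow> 0"
    using uv(3) unfolding zero_trace_on_def by blast
  obtain \<psi> where \<psi>: "\<And>j::nat. smooth_on UNIV (\<psi> j :: field)"
    "(\<lambda>j. \<integral>\<^sup>+x. ennreal ((norm (\<psi> j x - v x))\<^sup>2) \<partial>lebesgue_on \<Omega>) \<longlonglongrightarrow> 0"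
    "(\<lambda>j. \<integral>\<^sup>+x. ennreal ((norm (matrix (frechet_derivative (\<psi> j) (at x)) - grad \<Omega> v x))\<^sup>2)
           \<partial>lebesgue_on \<Omega>) \<longlonglongrightarrow> 0"
    "(\<lambda>j. \<integral>\<^sup>+x. ennreal ((norm (\<psi> j x))\<^sup>2) \<partial>restrict_space area_measure \<Gamma>) \<longlonglongrightarrow> 0"
    using uv(4) unfolding zero_trace_on_def by blast
  let ?h = "\<lambda>j x. c *\<^sub>R \<phi> j x + d *\<^sub>R \<psi> j x"
  have m [measurable]: "u \<in> borel_measurable (lebesgue_on \<Omega>)" "v \<in> borel_measurable (lebesgue_on \<Omega>)"
      "grad \<Omega> u \<in> borel_measurable (lebesgue_on \<Omega>)" "grad \<Omega> v \<in> borel_measurable (lebesgue_on \<Omega>)"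
    using H1_fields_L2[OF uv(1)] H1_fields_L2[OF uv(2)] grad_L2[OF uv(1)] grad_L2[OF uv(2)]
    by (simp_all add: L2_space_def)
  have m' [measurable]: "\<phi> j \<in> borel_measurable (lebesgue_on \<Omega>)" "\<psi> j \<in> borel_measurable (lebesgue_on \<Omega>)"
      "(\<lambda>x. matrix (frechet_derivative (\<phi> j) (at x))) \<in> borel_measurable (lebesgue_on \<Omega>)"
      "(\<lambda>x. matrix (frechet_derivative (\<psi> j) (at x))) \<in> borel_measurable (lebesgue_on \<Omega>)" for j
    using \<phi>(1) \<psi>(1)
    by (auto intro!: borel_measurable_lebesgue_on smooth_on_continuous smooth_on_continuous_matrix_derivative)
  have D: "matrix (frechet_derivative (?h j) (at x)) =
      c *\<^sub>R matrix (frechet_derivative (\<phi> j) (at x)) + d *\<^sub>R matrix (frechet_derivative (\<psi> j) (at x))" for j x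
  proof -
    have "frechet_derivative (?h j) (at x) =
        (\<lambda>i. c *\<^sub>R frechet_derivative (\<phi> j) (at x) i + d *\<^sub>R frechet_derivative (\<psi> j) (at x) i)"
      by (rule frechet_derivative_at[symmetric])
         (auto intro!: derivative_eq_intros frechet_derivative_works[THEN iffD1] smooth_on_differentiable \<phi>(1) \<psi>(1))
    then show ?thesis
      by (simp add: matrix_def vec_eq_iff)
  qed
  have "(\<lambda>j. \<integral>\<^sup>+x. ennreal ((norm (?h j x - w x))\<^sup>2) \<partial>lebesgue_on \<Omega>) \<longlonglongrightarrow> 0"
    by (rule nn_integral_square_lincomb_tendsto_0[OF _ \<phi>(2) _ \<psi>(2), of _ c d])
       (measurable, auto intro!: AE_I2 simp: w algebra_simps)
  moreover have "(\<lambda>j. \<integral>\<^sup>+x. ennreal ((norm (matrix (frechet_derivative (?h j) (at x)) - grad \<Omega> w x))\<^sup>2)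
           \<partial>lebesgue_on \<Omega>) \<longlonglongrightarrow> 0"
  proof (rule nn_integral_square_lincomb_tendsto_0[OF _ \<phi>(3) _ \<psi>(3), of _ c d])
    have "AE x in lebesgue_on \<Omega>. grad \<Omega> w x = c *\<^sub>R grad \<Omega> u x + d *\<^sub>R grad \<Omega> v x"
      using H1_fields_lincomb(2)[OF uv(1,2)] w by blast
    then show "AE x in lebesgue_on \<Omega>. matrix (frechet_derivative (?h j) (at x)) - grad \<Omega> w x =
        c *\<^sub>R (matrix (frechet_derivative (\<phi> j) (at x)) - grad \<Omega> u x)
        + d *\<^sub>R (matrix (frechet_derivative (\<psi> j) (at x)) - grad \<Omega> v x)" for j
      by (rule eventually_mono) (simp add: D algebra_simps)
  qed measurable
  moreover have "(\<lambda>j. \<integral>\<^sup>+x. ennreal ((norm (?h j x))\<^sup>2) \<partial>restrict_space area_measure \<Gamma>) \<longlonglongrightarrow> 0"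
    by (rule nn_integral_square_lincomb_tendsto_0[OF _ \<phi>(4) _ \<psi>(4), of _ c d])
       (auto intro!: borel_measurable_area smooth_on_continuous \<phi>(1) \<psi>(1))
  ultimately show ?thesis
    unfolding zero_trace_on_def using smooth_on_lincomb[OF \<phi>(1) \<psi>(1)]
    by (intro exI[of _ ?h]) blast
qed

section \<open>Finite element functions: linear combinations and pointwise vanishing\<close>

lemma subspace_on_FE_space: "subspace_on (closure \<Omega>) (FE_space \<Omega> \<Gamma> \<T> p)"
  if mesh: "\<And>K. K \<in> \<T> \<Longrightarrow> K \<subseteq> closure \<Omega>"
  unfolding subspace_on_def
proof (intro ballI allI impI)
  fix u v c d w
  assume u: "u \<in> FE_space \<Omega> \<Gamma> \<T> p" and v: "v \<in> FE_space \<Omega> \<Gamma> \<T> p"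
    and w: "\<forall>x\<in>closure \<Omega>. w x = c *\<^sub>R u x + d *\<^sub>R v x"
  have w': "\<And>x. x \<in> \<Omega> \<Longrightarrow> w x = c *\<^sub>R u x + d *\<^sub>R v x"
    using w closure_subset by blast
  have "w \<in> V_space \<Omega> \<Gamma>"
    using u v H1_fields_lincomb(1)[OF _ _ w'] zero_trace_on_lincomb[OF _ _ _ _ w']
    by (auto simp: FE_space_def V_space_def)
  moreover have "continuous_on (closure \<Omega>) w"
  proof (rule continuous_on_cong[THEN iffD1, OF refl])
    show "continuous_on (closure \<Omega>) (\<lambda>x. c *\<^sub>R u x + d *\<^sub>R v x)"
      using u v by (auto simp: FE_space_def intro!: continuous_intros)
  qed (use w in auto)
  moreover have "\<exists>q. polynomial_of_order p q \<and> (\<forall>x\<in>K. w x $ i = q x)" if K: "K \<in> \<T>" for K i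
  proof -
    obtain q where q: "polynomial_of_order p q" "\<forall>x\<in>K. u x $ i = q x"
      using u K unfolding FE_space_def by blast
    obtain r where r: "polynomial_of_order p r" "\<forall>x\<in>K. v x $ i = r x"
      using v K unfolding FE_space_def by blast
    obtain a b where a: "\<And>x. q x = (\<Sum>(i, j, k)\<in>{(i, j, k). i + j + k \<le> p}. a i j k * (x$1)^i * (x$2)^j * (x$3)^k)"
      and b: "\<And>x. r x = (\<Sum>(i, j, k)\<in>{(i, j, k). i + j + k \<le> p}. b i j k * (x$1)^i * (x$2)^j * (x$3)^k)"
      using q r unfolding polynomial_of_order_def by blast
    have "polynomial_of_order p (\<lambda>x. c * q x + d * r x)"
      unfolding polynomial_of_order_def a b
      by (rule exI[of _ "\<lambda>i j k. c * a i j k + d * b i j k"])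
         (simp add: sum_distrib_left sum.distrib[symmetric] case_prod_unfold algebra_simps)
    moreover have "\<forall>x\<in>K. w x $ i = c * q x + d * r x"
      using w q r mesh[OF K] by auto
    ultimately show ?thesis by blast
  qed
  ultimately show "w \<in> FE_space \<Omega> \<Gamma> \<T> p"
    by (auto simp: FE_space_def)
qed

text \<open>Inside \<Omega> the set where \<open>u\<close> does not vanish is open and negligible,
  hence empty; continuity carries the value 0 to the boundary. This turns definiteness modulo null
  sets into pointwise statements.\<close>

lemma zero_on_closure_if_AE_zero:
  assumes u: "continuous_on (closure \<Omega>) u" and "AE x in lebesgue_on \<Omega>. u x = (0 :: real^3)"
    and "x \<in> closure \<Omega>"
  shows "u x = 0"
proof (rule continuous_constant_on_closure[OF u _ assms(3)])
  let ?Z = "\<Omega> \<inter> u -` (- {0})"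
  have "AE x in lebesgue. x \<in> \<Omega> \<longrightarrow> u x = 0"
    using assms(2) by (simp add: AE_restrict_space_iff)
  then obtain N where N: "\<And>x. x \<in> space lebesgue - N \<Longrightarrow> x \<in> \<Omega> \<longrightarrow> u x = 0" "N \<in> null_sets lebesgue"
    using AE_E3 by blast
  then have "?Z \<subseteq> N" by auto
  with N(2) have "negligible ?Z"
    by (intro negligible_subset[of N ?Z]) (auto simp: negligible_iff_null_sets)
  moreover have "open ?Z"
    using u open_domain by (intro continuous_open_preimage continuous_on_subset[OF u closure_subset]) auto
  ultimately have "?Z = {}"
    using open_not_negligible by blast
  then show "u x = 0" if "x \<in> \<Omega>" for x
    using that by auto
qed

end

subsection \<open>Integrability of the load in time\<close>

lemma finite_measure_lebesgue_on_half_open: "finite_measure (lebesgue_on {l<..r :: real})"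
proof (intro finite_measure_lebesgue_on bounded_set_imp_lmeasurable)
  show "bounded {l<..r}"
    by (rule bounded_subset[of "{l..r}"]) auto
qed auto

text \<open>
  If \<open>q\<close> is not integrable, then \<open>p + s q\<close> is integrable for at most one \<open>s\<close>, and the integral has
  the junk value 0 for all others. This is why the traction term can be handled without knowing that
  \<open>\<Gamma>\<^sub>N\<close> has finite area.
\<close>

lemma integrable_integral_affine:
  fixes p q :: "'a \<Rightarrow> real"
  shows "integrable (lebesgue_on {l<..r}) (\<lambda>s. \<integral>x. p x + s * q x \<partial>N)"
proof (cases "integrable N q")
  case q: True
  show ?thesis
  proof (cases "integrable N p")
    case True
    then have "(\<lambda>s. \<integral>x. p x + s * q x \<partial>N) = (\<lambda>s. (\<integral>x. p x \<partial>N) + s * (\<integral>x. q x \<partial>N))"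
      using q by (simp add: fun_eq_iff)
    moreover have "integrable (lebesgue_on {l<..r}) (\<lambda>s. (\<integral>x. p x \<partial>N) + s * (\<integral>x. q x \<partial>N))"
    proof (rule finite_measure.integrable_const_bound[where B = "\<bar>\<integral>x. p x \<partial>N\<bar> + max \<bar>l\<bar> \<bar>r\<bar> * \<bar>\<integral>x. q x \<partial>N\<bar>"])
      show "finite_measure (lebesgue_on {l<..r})"
        by (rule finite_measure_lebesgue_on_half_open)
      show "AE s in lebesgue_on {l<..r}. norm ((\<integral>x. p x \<partial>N) + s * (\<integral>x. q x \<partial>N))
          \<le> \<bar>\<integral>x. p x \<partial>N\<bar> + max \<bar>l\<bar> \<bar>r\<bar> * \<bar>\<integral>x. q x \<partial>N\<bar>"
        by (intro AE_I2) (auto simp: abs_mult intro!: order_trans[OF abs_triangle_ineq] add_mono mult_right_mono)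
      show "(\<lambda>s. (\<integral>x. p x \<partial>N) + s * (\<integral>x. q x \<partial>N)) \<in> borel_measurable (lebesgue_on {l<..r})"
        by (intro continuous_imp_measurable_on_sets_lebesgue continuous_intros) auto
    qed
    ultimately show ?thesis by simp
  next
    case False
    have "\<not> integrable N (\<lambda>x. p x + s * q x)" for s
    proof
      assume "integrable N (\<lambda>x. p x + s * q x)"
      then have "integrable N (\<lambda>x. (p x + s * q x) - s * q x)"
        using q by (intro Bochner_Integration.integrable_diff) auto
      with False show False by simp
    qed
    then show ?thesis by (simp add: not_integrable_integral_eq)
  qed
next
  case False
  have unique: "s = s'" if "integrable N (\<lambda>x. p x + s * q x)" "integrable N (\<lambda>x. p x + s' * q x)" for s s'
  proof (rule ccontr)
    assume "s \<noteq> s'"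
    have "integrable N (\<lambda>x. inverse (s - s') * ((p x + s * q x) - (p x + s' * q x)))"
      using that by (intro integrable_mult_right Bochner_Integration.integrable_diff)
    moreover have "(\<lambda>x. inverse (s - s') * ((p x + s * q x) - (p x + s' * q x))) = q"
      using \<open>s \<noteq> s'\<close> by (auto simp: fun_eq_iff field_simps)
    ultimately have "integrable N q" by (simp only:)
    with False show False by contradiction
  qed
  obtain s0 where s0: "\<And>s. s \<noteq> s0 \<Longrightarrow> \<not> integrable N (\<lambda>x. p x + s * q x)"
    using unique by metis
  have "(\<lambda>s. \<integral>x. p x + s * q x \<partial>N) = (\<lambda>s. (\<integral>x. p x + s0 * q x \<partial>N) * indicator {s0} s)"
    using s0 by (auto simp: fun_eq_iff not_integrable_integral_eq indicator_def)
  moreover have "integrable (lebesgue_on {l<..r}) (\<lambda>s. (\<integral>x. p x + s0 * q x \<partial>N) * indicator {s0} s)"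
  proof (rule finite_measure.integrable_const_bound[where B = "\<bar>\<integral>x. p x + s0 * q x \<partial>N\<bar>"])
    show "finite_measure (lebesgue_on {l<..r})"
      by (rule finite_measure_lebesgue_on_half_open)
    show "(\<lambda>s. (\<integral>x. p x + s0 * q x \<partial>N) * indicator {s0} s) \<in> borel_measurable (lebesgue_on {l<..r})"
      by (intro borel_measurable_times borel_measurable_const measurable_restrict_space1 borel_measurable_indicator) auto
  qed (auto simp: indicator_def)
  ultimately show ?thesis by simp
qed

lemma L2_inner_Cauchy_Schwarz:
  assumes f: "f \<in> L2_space N" and g: "g \<in> L2_space N"
  shows "\<bar>L2_inner N f g\<bar> \<le> L2_norm N f * L2_norm N g"
proof -
  let ?a = "L2_inner N f f" and ?b = "L2_inner N f g" and ?c = "L2_inner N g g"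
  have nonneg: "0 \<le> L2_inner N h h" for h :: "'a \<Rightarrow> 'b"
    unfolding L2_inner_def by (intro integral_nonneg_AE) auto
  \<comment> \<open>The squared norm of f + y g is a quadratic in \<open>y\<close> that is never
    negative; the inequality is the statement about its discriminant.\<close>
  have quad: "0 \<le> ?a + 2 * y * ?b + y\<^sup>2 * ?c" for y
  proof -
    let ?h = "\<lambda>x. 1 *\<^sub>R f x + y *\<^sub>R g x"
    have h: "?h \<in> L2_space N"
      by (rule L2_space_lincomb[OF f g])
    then have hm: "?h \<in> borel_measurable N"
      by (simp add: L2_space_def)
    have *: "L2_inner N ?h k = 1 * L2_inner N f k + y * L2_inner N g k" if "k \<in> L2_space N" for k
      by (rule L2_inner_lincomb_left[OF f g that hm]) simp
    have "L2_inner N ?h ?h = L2_inner N f ?h + y * L2_inner N g ?h"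
      using *[OF h] by simp
    also have "\<dots> = (?a + y * ?b) + y * (?b + y * ?c)"
      using *[OF f] *[OF g] by (simp add: L2_inner_commute)
    finally show ?thesis
      using nonneg[of ?h] by (simp add: algebra_simps power2_eq_square)
  qed
  have "?b\<^sup>2 \<le> ?a * ?c"
  proof (cases "?c = 0")
    case True
    have "?b = 0"
    proof (rule ccontr)
      assume "?b \<noteq> 0"
      \<comment> \<open>With leading coefficient 0 the quadratic is affine, and this choice of
        \<open>y\<close> gives it the value -1.\<close>
      then show False
        using quad[of "- (?a + 1) / (2 * ?b)"] True by (simp add: field_simps)
    qed
    then show ?thesis using True by simp
  next
    case False
    then have c: "0 < ?c" using nonneg[of g] by simp
    \<comment> \<open>The quadratic is evaluated at its minimiser.\<close>
    have "0 \<le> (?a + 2 * (- ?b / ?c) * ?b + (- ?b / ?c)\<^sup>2 * ?c) * ?c"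
      using mult_nonneg_nonneg[OF quad less_imp_le[OF c]] .
    also have "\<dots> = ?a * ?c - ?b\<^sup>2"
      using c by (simp add: field_simps power2_eq_square)
    finally show ?thesis by simp
  qed
  then have "sqrt (?b\<^sup>2) \<le> sqrt (?a * ?c)"
    by (rule real_sqrt_le_mono)
  then show ?thesis
    by (simp add: L2_norm_def real_sqrt_mult)
qed

lemma integrable_lebesgue_on_subset:
  fixes F :: "real \<Rightarrow> real"
  assumes "integrable (lebesgue_on A) F" "A \<in> sets lebesgue" "B \<in> sets lebesgue" "B \<subseteq> A"
  shows "integrable (lebesgue_on B) F"
proof -
  have "integrable lebesgue (\<lambda>x. indicator A x *\<^sub>R F x)"
    using assms by (simp add: integrable_restrict_space)
  then have "integrable lebesgue (\<lambda>x. indicator B x *\<^sub>R (indicator A x *\<^sub>R F x))"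
    using assms(3) by (rule integrable_mult_indicator[rotated])
  moreover have "(\<lambda>x. indicator B x *\<^sub>R (indicator A x *\<^sub>R F x)) = (\<lambda>x. indicator B x *\<^sub>R F x)"
    using assms(4) by (auto simp: fun_eq_iff indicator_def)
  ultimately show ?thesis
    using assms by (simp add: integrable_restrict_space)
qed

text \<open>Cauchy-Schwarz in space bounds the function of time by the norm of \<open>f s\<close>,
  integrable by assumption, times a constant. Its measurability comes from joint measurability of
  \<open>f\<close>, as an inner integral over a sigma-finite measure.\<close>

lemma integrable_force:
  assumes f: "L1_in_time_L2 \<Omega> T f" and w: "w \<in> L2_space (lebesgue_on \<Omega>)" and \<Omega>: "\<Omega> \<in> lmeasurable"
  shows "integrable (lebesgue_on {0..T}) (\<lambda>s. L2_inner (lebesgue_on \<Omega>) (f s) w)"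
proof (rule Bochner_Integration.integrable_bound)
  show "integrable (lebesgue_on {0..T})
      (\<lambda>s. L2_norm (lebesgue_on \<Omega>) (f s) * L2_norm (lebesgue_on \<Omega>) w)"
    using f by (simp add: L1_in_time_L2_def)
  have [measurable]: "(\<lambda>(s, x). f s x) \<in> borel_measurable (lebesgue_on {0..T} \<Otimes>\<^sub>M lebesgue_on \<Omega>)"
      "w \<in> borel_measurable (lebesgue_on \<Omega>)"
    using f w by (auto simp: L1_in_time_L2_def L2_space_def)
  have "sigma_finite_measure (lebesgue_on \<Omega>)"
    using finite_measure_lebesgue_on[OF \<Omega>] by (rule finite_measure.axioms)
  moreover have "(\<lambda>(s, x). f s x \<bullet> w x) \<in> borel_measurable (lebesgue_on {0..T} \<Otimes>\<^sub>M lebesgue_on \<Omega>)"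
    by measurable
  ultimately show "(\<lambda>s. L2_inner (lebesgue_on \<Omega>) (f s) w) \<in> borel_measurable (lebesgue_on {0..T})"
    unfolding L2_inner_def by (rule sigma_finite_measure.borel_measurable_lebesgue_integral)
  have "AE s in lebesgue_on {0..T}. f s \<in> L2_space (lebesgue_on \<Omega>)"
    using f by (simp add: L1_in_time_L2_def)
  then show "AE s in lebesgue_on {0..T}. norm (L2_inner (lebesgue_on \<Omega>) (f s) w)
      \<le> norm (L2_norm (lebesgue_on \<Omega>) (f s) * L2_norm (lebesgue_on \<Omega>) w)"
    by eventually_elim (use L2_inner_Cauchy_Schwarz[OF _ w] in \<open>smt (verit) real_norm_def\<close>)
qed

text \<open>Needed to split the time integral of the reduced load into the load and a part that is
  constant in time. The traction contributes a spatial integral whose integrand is affine in time on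
  the cell.\<close>

lemma integrable_load:
  assumes f: "L1_in_time_L2 \<Omega> T f" and g: "g \<in> P1_time \<Gamma> {l<..r} S"
    and w: "w \<in> L2_space (lebesgue_on \<Omega>)" and \<Omega>: "\<Omega> \<in> lmeasurable" and lr: "0 \<le> l" "r \<le> T"
  shows "integrable (lebesgue_on {l<..r}) (\<lambda>s. load \<Omega> \<Gamma> (f s) (g s) w)"
proof -
  let ?N = "restrict_space area_measure \<Gamma>"
  have force: "integrable (lebesgue_on {l<..r}) (\<lambda>s. L2_inner (lebesgue_on \<Omega>) (f s) w)"
    by (rule integrable_lebesgue_on_subset[OF integrable_force[OF f w \<Omega>]]) (use lr in auto)
  obtain a b where g: "\<And>s x. s \<in> {l<..r} \<Longrightarrow> x \<in> \<Gamma> \<Longrightarrow> g s x = a x + s *\<^sub>R b x"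
    using g unfolding P1_time_def by blast
  have "integrable (lebesgue_on {l<..r}) (\<lambda>s. \<integral>x. a x \<bullet> w x + s * (b x \<bullet> w x) \<partial>?N)"
    by (rule integrable_integral_affine)
  moreover have "L2_inner ?N (g s) w = (\<integral>x. a x \<bullet> w x + s * (b x \<bullet> w x) \<partial>?N)" if "s \<in> {l<..r}" for s
    unfolding L2_inner_def using that
    by (intro Bochner_Integration.integral_cong) (auto simp: g space_restrict_space inner_simps)
  then have "integrable (lebesgue_on {l<..r}) (\<lambda>s. L2_inner ?N (g s) w) =
      integrable (lebesgue_on {l<..r}) (\<lambda>s. \<integral>x. a x \<bullet> w x + s * (b x \<bullet> w x) \<partial>?N)"
    by (intro Bochner_Integration.integrable_cong) auto
  ultimately show ?thesis
    unfolding load_def using force by simp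
qed

subsection \<open>One time step\<close>

lemma has_bochner_integral_ident_half_open:
  assumes "l \<le> (r :: real)"
  shows "has_bochner_integral (lebesgue_on {l<..r}) (\<lambda>s. s) ((r\<^sup>2 - l\<^sup>2) / 2)"
proof -
  have int: "integrable (lebesgue_on {l<..r}) (\<lambda>s. s)"
  proof (rule finite_measure.integrable_const_bound[OF finite_measure_lebesgue_on_half_open, where B = "max \<bar>l\<bar> \<bar>r\<bar>"])
    show "AE s in lebesgue_on {l<..r}. norm s \<le> max \<bar>l\<bar> \<bar>r\<bar>"
      by (intro AE_I2) auto
    show "(\<lambda>s. s) \<in> borel_measurable (lebesgue_on {l<..r})"
      by (intro continuous_imp_measurable_on_sets_lebesgue continuous_intros) auto
  qed
  have "((\<lambda>s. s) has_integral (r\<^sup>2 - l\<^sup>2) / 2) {l<..r}"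
  proof (rule has_integral_spike_set_eq[THEN iffD1, OF _ _ ident_has_integral[OF assms]])
    show "negligible {s \<in> {l..r} - {l<..r}. s \<noteq> 0}"
      by (rule negligible_subset[of "{l}"]) auto
    show "negligible {s \<in> {l<..r} - {l..r}. s \<noteq> 0}"
      by (rule negligible_subset[of "{}"]) auto
  qed
  then have "integral\<^sup>L (lebesgue_on {l<..r}) (\<lambda>s. s) = (r\<^sup>2 - l\<^sup>2) / 2"
    using int by (subst lebesgue_integral_eq_integral) (auto simp: integral_unique)
  with int show ?thesis
    by (simp add: has_bochner_integral_iff)
qed

lemma has_bochner_integral_const_half_open:
  assumes "l \<le> (r :: real)"
  shows "has_bochner_integral (lebesgue_on {l<..r}) (\<lambda>s. c :: real) ((r - l) * c)"
proof -
  interpret finite_measure "lebesgue_on {l<..r}"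
    by (rule finite_measure_lebesgue_on_half_open)
  have "measure (lebesgue_on {l<..r}) (space (lebesgue_on {l<..r})) = r - l"
    using assms by (simp add: measure_restrict_space)
  then show ?thesis
    by (simp add: has_bochner_integral_iff)
qed

text \<open>The trapezoidal rule, exact for affine integrands, in the barycentric form in which
  piecewise linear functions enter.\<close>

lemma has_bochner_integral_affine_half_open:
  assumes "l < (r :: real)"
  shows "has_bochner_integral (lebesgue_on {l<..r})
    (\<lambda>s. (r - s) / (r - l) * a + (s - l) / (r - l) * b) ((r - l) / 2 * (a + b))"
proof -
  have "has_bochner_integral (lebesgue_on {l<..r})
      (\<lambda>s. (r * a - l * b) / (r - l) + (b - a) / (r - l) * s)
      ((r - l) * ((r * a - l * b) / (r - l)) + (b - a) / (r - l) * ((r\<^sup>2 - l\<^sup>2) / 2))"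
    using assms
    by (intro has_bochner_integral_add has_bochner_integral_const_half_open
        has_bochner_integral_mult_right has_bochner_integral_ident_half_open) auto
  moreover have "(\<lambda>s. (r * a - l * b) / (r - l) + (b - a) / (r - l) * s) =
      (\<lambda>s. (r - s) / (r - l) * a + (s - l) / (r - l) * b)"
    by (auto simp: fun_eq_iff add_divide_distrib[symmetric] algebra_simps)
  moreover have "(r - l) * ((r * a - l * b) / (r - l)) + (b - a) / (r - l) * ((r\<^sup>2 - l\<^sup>2) / 2) =
      (r - l) / 2 * (a + b)"
    using assms by (simp add: divide_simps power2_eq_square) (simp add: algebra_simps)
  ultimately show ?thesis by (simp only:)
qed

text \<open>The space prescribes \<open>U\<close> only on the half-open cell. Right continuity
  forces the value at \<open>l\<close> to be that of the same affine expression, so on the closed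
  cell \<open>U\<close> interpolates its two endpoint values.\<close>

lemma P1_time_endpoints:
  assumes U: "U \<in> P1_time X {l<..r} S" and rc: "right_continuous X U l" and lr: "l < r"
  shows "s \<in> {l..r} \<Longrightarrow> x \<in> X \<Longrightarrow> U s x = ((r - s) / (r - l)) *\<^sub>R U l x + ((s - l) / (r - l)) *\<^sub>R U r x"
    and "s \<in> {l<..r} \<Longrightarrow> x \<in> X \<Longrightarrow>
      time_deriv {l<..r} U s x = (1 / (r - l)) *\<^sub>R U r x + (- 1 / (r - l)) *\<^sub>R U l x"
    and "subspace_on X S \<Longrightarrow> s \<in> {l..r} \<Longrightarrow> U s \<in> S"
proof -
  obtain a b where ab: "a \<in> S" "b \<in> S" "\<And>s x. s \<in> {l<..r} \<Longrightarrow> x \<in> X \<Longrightarrow> U s x = a x + s *\<^sub>R b x"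
    using U unfolding P1_time_def by blast
  have left: "U l x = a x + l *\<^sub>R b x" if x: "x \<in> X" for x
  proof -
    have "((\<lambda>s. a x + s *\<^sub>R b x) \<longlongrightarrow> a x + l *\<^sub>R b x) (at_right l)"
      by (intro tendsto_intros)
    moreover have "eventually (\<lambda>s. a x + s *\<^sub>R b x = U s x) (at_right l)"
      using eventually_at_right_real[OF lr] by eventually_elim (use ab(3) x in auto)
    ultimately have "((\<lambda>s. U s x) \<longlongrightarrow> a x + l *\<^sub>R b x) (at_right l)"
      by (rule Lim_transform_eventually)
    moreover have "((\<lambda>s. U s x) \<longlongrightarrow> U l x) (at_right l)"
      using rc x by (simp add: right_continuous_def)
    ultimately show ?thesis
      using tendsto_unique trivial_limit_at_right_real by metis
  qed
  have all: "U s x = a x + s *\<^sub>R b x" if "s \<in> {l..r}" "x \<in> X" for s x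
    using that left ab(3) by (cases "s = l") auto
  have left: "U l x = a x + l *\<^sub>R b x" and right: "U r x = a x + r *\<^sub>R b x" if "x \<in> X" for x
    using all that lr by auto
  show "U s x = ((r - s) / (r - l)) *\<^sub>R U l x + ((s - l) / (r - l)) *\<^sub>R U r x"
    if "s \<in> {l..r}" "x \<in> X"
  proof -
    have "((r - s) / (r - l)) *\<^sub>R U l x + ((s - l) / (r - l)) *\<^sub>R U r x =
        ((r - s) / (r - l) + (s - l) / (r - l)) *\<^sub>R a x + ((r - s) / (r - l) * l + (s - l) / (r - l) * r) *\<^sub>R b x"
      using that by (simp add: left right algebra_simps)
    also have "(r - s) / (r - l) + (s - l) / (r - l) = 1"
      using lr by (simp add: add_divide_distrib[symmetric])
    also have "(r - s) / (r - l) * l + (s - l) / (r - l) * r = s"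
      using lr by (simp add: divide_simps) (simp add: algebra_simps)
    finally show ?thesis
      using all that by simp
  qed
  show "time_deriv {l<..r} U s x = (1 / (r - l)) *\<^sub>R U r x + (- 1 / (r - l)) *\<^sub>R U l x"
    if s: "s \<in> {l<..r}" and x: "x \<in> X"
  proof -
    have "((\<lambda>s. a x + s *\<^sub>R b x) has_vector_derivative b x) (at s within {l<..r})"
      by (auto intro!: derivative_eq_intros)
    then have "((\<lambda>s. U s x) has_vector_derivative b x) (at s within {l<..r})"
      by (rule has_vector_derivative_transform[OF s, rotated]) (use ab(3) x in auto)
    \<comment> \<open>The derivative within the cell is unique even at the right end
      \<open>r\<close>, where it is one-sided: \<open>r\<close> is still a limit point of the
      cell.\<close>
    moreover have "at s within {l<..r} \<noteq> bot"
      using s lr by (simp add: trivial_limit_within)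
    ultimately have "time_deriv {l<..r} U s x = b x"
      by (simp add: time_deriv_def vector_derivative_within)
    moreover have "(1 / (r - l)) *\<^sub>R U r x + (- 1 / (r - l)) *\<^sub>R U l x = (r / (r - l) - l / (r - l)) *\<^sub>R b x"
      using x by (simp add: left right algebra_simps)
    moreover have "r / (r - l) - l / (r - l) = 1"
      using lr by (simp add: diff_divide_distrib[symmetric])
    ultimately show ?thesis by simp
  qed
  show "U s \<in> S" if "subspace_on X S" "s \<in> {l..r}"
    by (rule subspace_onD[OF that(1) ab(1,2), of _ 1 s]) (use all that in auto)
qed

text \<open>A linear functional of \<open>U\<close> is affine in time and that of its derivative is
  constant, so both integrals depend on the endpoint values alone: through the trapezoidal rule and
  as the total increment.\<close>

lemma has_bochner_integral_P1_time:
  assumes F: "linear_on X S F" and sub: "subspace_on X S"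
    and U: "U \<in> P1_time X {l<..r} S" "right_continuous X U l" "l < r"
  shows "has_bochner_integral (lebesgue_on {l<..r}) (\<lambda>s. F (U s)) ((r - l) / 2 * (F (U l) + F (U r)))"
    and "has_bochner_integral (lebesgue_on {l<..r}) (\<lambda>s. F (time_deriv {l<..r} U s)) (F (U r) - F (U l))"
proof -
  have ends: "U l \<in> S" "U r \<in> S"
    using P1_time_endpoints(3)[OF U sub] U(3) by auto
  have "has_bochner_integral (lebesgue_on {l<..r}) (\<lambda>s. F (U s)) y \<longleftrightarrow>
      has_bochner_integral (lebesgue_on {l<..r})
        (\<lambda>s. (r - s) / (r - l) * F (U l) + (s - l) / (r - l) * F (U r)) y" for y
  proof (rule has_bochner_integral_cong[OF refl _ refl])
    fix s assume "s \<in> space (lebesgue_on {l<..r})"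
    then have s: "s \<in> {l..r}" by simp
    show "F (U s) = (r - s) / (r - l) * F (U l) + (s - l) / (r - l) * F (U r)"
      using P1_time_endpoints(1)[OF U s] by (rule linear_onD[OF F ends])
  qed
  then show "has_bochner_integral (lebesgue_on {l<..r}) (\<lambda>s. F (U s)) ((r - l) / 2 * (F (U l) + F (U r)))"
    using has_bochner_integral_affine_half_open[OF U(3)] by (simp only:)
  have "has_bochner_integral (lebesgue_on {l<..r}) (\<lambda>s. F (time_deriv {l<..r} U s)) y \<longleftrightarrow>
      has_bochner_integral (lebesgue_on {l<..r})
        (\<lambda>s. 1 / (r - l) * F (U r) + (- 1 / (r - l)) * F (U l)) y" for y
  proof (rule has_bochner_integral_cong[OF refl _ refl])
    fix s assume "s \<in> space (lebesgue_on {l<..r})"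
    then have s: "s \<in> {l<..r}" by simp
    show "F (time_deriv {l<..r} U s) = 1 / (r - l) * F (U r) + (- 1 / (r - l)) * F (U l)"
      using P1_time_endpoints(2)[OF U s] by (rule linear_onD[OF F ends(2,1)])
  qed
  moreover have "F (U r) - F (U l) = (r - l) * (1 / (r - l) * F (U r) + (- 1 / (r - l)) * F (U l))"
    using U(3) by (simp add: divide_simps)
  ultimately show "has_bochner_integral (lebesgue_on {l<..r}) (\<lambda>s. F (time_deriv {l<..r} U s)) (F (U r) - F (U l))"
    using has_bochner_integral_const_half_open[OF less_imp_le[OF U(3)]] by (simp only:)
qed

section \<open>The algebra of a single time step\<close>

lemma P0_time_const: "w \<in> S \<Longrightarrow> (\<lambda>s. w) \<in> P0_time X I S"
  by (auto simp: P0_time_def)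

lemma linear_on_zero:
  assumes "linear_on X S F" "u \<in> S" "\<And>x. x \<in> X \<Longrightarrow> z x = 0"
  shows "F z = 0"
  using linear_onD[OF assms(1,2,2), of z 0 0] assms(3) by simp

lemma linear_on_cong:
  assumes "linear_on X S F" "u \<in> S" "\<And>x. x \<in> X \<Longrightarrow> v x = u x"
  shows "F v = F u"
  using linear_onD[OF assms(1,2,2), of v 1 0] assms(3) by simp

text \<open>Definiteness has the form that a nonpositive value implies vanishing, because the energy
  argument delivers an upper bound. Mass and elasticity occur jointly, since the differences in
  velocity and displacement are shown to vanish together. Vanishing is meant pointwise on
  \<open>X\<close>.\<close>

locale viscoelastic_forms =
  fixes X :: "point set" and S :: "field set" and M :: nat and \<tau> :: "nat \<Rightarrow> real"
    and mass aE :: "field \<Rightarrow> field \<Rightarrow> real" and aV :: "nat \<Rightarrow> field \<Rightarrow> field \<Rightarrow> real"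
  assumes sub: "subspace_on X S" and zero: "(\<lambda>x. 0) \<in> S"
    and mass: "bilinear_on X S mass" and aE: "bilinear_on X S aE"
    and aV: "m \<in> {1..M} \<Longrightarrow> bilinear_on X S (aV m)"
    and aE_sym: "u \<in> S \<Longrightarrow> v \<in> S \<Longrightarrow> aE u v = aE v u"
    and aV_nonneg: "m \<in> {1..M} \<Longrightarrow> 0 \<le> aV m u u"
    and aV_definite: "m \<in> {1..M} \<Longrightarrow> u \<in> S \<Longrightarrow> aV m u u \<le> 0 \<Longrightarrow> x \<in> X \<Longrightarrow> u x = 0"
    and elastic_definite: "u \<in> S \<Longrightarrow> v \<in> S \<Longrightarrow> mass u u + aE v v \<le> 0 \<Longrightarrow> x \<in> X \<Longrightarrow> u x = 0 \<and> v x = 0"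
    and \<tau>_pos: "m \<in> {1..M} \<Longrightarrow> \<tau> m > 0"
begin

text \<open>The cell equation after exact integration in time, with \<open>p\<close> and
  \<open>q\<close> the states at the left and right ends: increments come from the time derivative,
  trapezoidal averages from \<open>B\<close>. \<open>L\<close> stands for the load integrated over
  the cell.\<close>

definition complete_step :: "real \<Rightarrow> (field \<Rightarrow> real) \<Rightarrow> state \<Rightarrow> state \<Rightarrow> bool" where
  "complete_step k L p q \<longleftrightarrow> (case (p, q) of ((p1, p0, pV), (q1, q0, qV)) \<Rightarrow>
     \<forall>w1\<in>S. \<forall>w0\<in>S. \<forall>wV. (\<forall>m\<in>{1..M}. wV m \<in> S) \<longrightarrow>
       mass q1 w1 - mass p1 w1 + (aE q0 w0 - aE p0 w0) + (\<Sum>m=1..M. aV m (qV m) (wV m) - aV m (pV m) (wV m))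
       + (k / 2 * (aE p0 w1 + aE q0 w1) - k / 2 * (aE p1 w0 + aE q1 w0)
         + (\<Sum>m=1..M. k / 2 * (aV m (pV m) w1 + aV m (qV m) w1) - k / 2 * (aV m p1 (wV m) + aV m q1 (wV m))
              + 1 / \<tau> m * (k / 2 * (aV m (pV m) (wV m) + aV m (qV m) (wV m))))) = L w1)"

text \<open>The last sum carries the full factor \<open>k\<close> because the old internal variable
  is frozen over the cell, so its contribution to the load is constant in time.\<close>

definition reduced_step :: "real \<Rightarrow> (field \<Rightarrow> real) \<Rightarrow> state \<Rightarrow> field \<times> field \<Rightarrow> bool" where
  "reduced_step k L p q \<longleftrightarrow> (case (p, q) of ((p1, p0, pV), (q1, q0)) \<Rightarrow>
     \<forall>w1\<in>S. \<forall>w0\<in>S.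
       mass q1 w1 - mass p1 w1 + (aE q0 w0 - aE p0 w0)
       + (k / 2 * (aE p0 w1 + aE q0 w1) - k / 2 * (aE p1 w0 + aE q1 w0)
         + (\<Sum>m=1..M. \<alpha>_coeff k (\<tau> m) * (k / 2 * (aV m p1 w1 + aV m q1 w1))))
       = L w1 - k * (\<Sum>m=1..M. (1 + \<beta>_coeff k (\<tau> m)) / 2 * aV m (pV m) w1))"

text \<open>
  Testing with an internal variable only shows that the residual of the update formula is
  \<open>a\<^sub>V\<^sub>E\<close>-orthogonal to the whole space, in particular to itself.
\<close>

lemma complete_step_internal_variable:
  assumes k: "k > 0" and L: "L (\<lambda>x. 0) = 0"
    and S: "p1 \<in> S" "q1 \<in> S" "\<And>m. m \<in> {1..M} \<Longrightarrow> pV m \<in> S" "\<And>m. m \<in> {1..M} \<Longrightarrow> qV m \<in> S"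
      "p0 \<in> S" "q0 \<in> S"
    and step: "complete_step k L (p1, p0, pV) (q1, q0, qV)"
    and m: "m \<in> {1..M}" and x: "x \<in> X"
  shows "qV m x = \<alpha>_coeff k (\<tau> m) *\<^sub>R (q1 x + p1 x) + \<beta>_coeff k (\<tau> m) *\<^sub>R pV m x"
proof -
  let ?\<alpha> = "\<alpha>_coeff k (\<tau> m)" and ?\<beta> = "\<beta>_coeff k (\<tau> m)" and ?o = "\<lambda>x. 0 :: real^3"
  define y where "y = (\<lambda>x. 1 *\<^sub>R q1 x + 1 *\<^sub>R p1 x)"
  define e where "e = (\<lambda>x. ?\<alpha> *\<^sub>R y x + ?\<beta> *\<^sub>R pV m x)"
  define z where "z = (\<lambda>x. 1 *\<^sub>R qV m x + (- 1) *\<^sub>R e x)"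
  have y: "y \<in> S"
    by (rule subspace_onD[OF sub S(2,1), of _ 1 1]) (simp add: y_def)
  have e: "e \<in> S"
    by (rule subspace_onD[OF sub y S(3)[OF m], of _ ?\<alpha> ?\<beta>]) (simp add: e_def)
  have z: "z \<in> S"
    by (rule subspace_onD[OF sub S(4)[OF m] e, of _ 1 "- 1"]) (simp add: z_def)
  define wV where "wV = (\<lambda>j. if j = m then z else ?o)"
  have wV: "\<forall>j\<in>{1..M}. wV j \<in> S"
    using z zero by (simp add: wV_def)
  have zero_right: "b u ?o = 0" if "bilinear_on X S b" "u \<in> S" for b u
    using linear_on_zero[OF bilinear_onD(2)[OF that] zero] by simp
  have collapse: "(\<Sum>j=1..M. G j) = G m" if "\<And>j. j \<in> {1..M} \<Longrightarrow> j \<noteq> m \<Longrightarrow> G j = 0" for G :: "nat \<Rightarrow> real"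
    using m that by (subst sum.remove[of _ m]) (auto intro!: sum.neutral)
  define F where "F u = aV m u z" for u
  have F: "linear_on X S F"
    unfolding F_def using bilinear_onD(1)[OF aV[OF m] z] .
  have "mass q1 ?o - mass p1 ?o + (aE q0 ?o - aE p0 ?o) + (\<Sum>j=1..M. aV j (qV j) (wV j) - aV j (pV j) (wV j))
       + (k / 2 * (aE p0 ?o + aE q0 ?o) - k / 2 * (aE p1 ?o + aE q1 ?o)
         + (\<Sum>j=1..M. k / 2 * (aV j (pV j) ?o + aV j (qV j) ?o) - k / 2 * (aV j p1 (wV j) + aV j q1 (wV j))
              + 1 / \<tau> j * (k / 2 * (aV j (pV j) (wV j) + aV j (qV j) (wV j))))) = L ?o"
    using step zero wV unfolding complete_step_def by simp
  also have "(\<Sum>j=1..M. aV j (qV j) (wV j) - aV j (pV j) (wV j)) = F (qV m) - F (pV m)"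
    by (subst collapse) (auto simp: wV_def F_def zero_right[OF aV] S)
  also have "(\<Sum>j=1..M. k / 2 * (aV j (pV j) ?o + aV j (qV j) ?o) - k / 2 * (aV j p1 (wV j) + aV j q1 (wV j))
              + 1 / \<tau> j * (k / 2 * (aV j (pV j) (wV j) + aV j (qV j) (wV j)))) =
      - (k / 2 * (F p1 + F q1)) + 1 / \<tau> m * (k / 2 * (F (pV m) + F (qV m)))"
    by (subst collapse) (use m in \<open>auto simp: wV_def F_def zero_right[OF aV] S\<close>)
  finally have eq: "F (qV m) - F (pV m) - k / 2 * (F p1 + F q1)
      + 1 / \<tau> m * (k / 2 * (F (pV m) + F (qV m))) = 0"
    using L by (simp add: zero_right[OF mass] zero_right[OF aE] S)
  have "F z = 1 * F (qV m) + (- 1) * F e"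
    by (rule linear_onD[OF F S(4)[OF m] e]) (simp add: z_def)
  moreover have "F e = ?\<alpha> * F y + ?\<beta> * F (pV m)"
    by (rule linear_onD[OF F y S(3)[OF m]]) (simp add: e_def)
  moreover have "F y = 1 * F q1 + 1 * F p1"
    by (rule linear_onD[OF F S(2,1)]) (simp add: y_def)
  ultimately have Fz: "F z = F (qV m) - (?\<alpha> * (F q1 + F p1) + ?\<beta> * F (pV m))"
    by simp
  define c where "c = k / \<tau> m"
  have c: "c > 0"
    using k \<tau>_pos[OF m] by (simp add: c_def)
  \<comment> \<open>Multiplying by 2 + k/\<tau> clears the denominators of \<alpha> and \<beta>, and
    the result is exactly twice the tested equation. This is the origin of the two coefficients:
    they solve that equation for the new internal variable.\<close>
  have "(2 + c) * F z = (2 + c) * F (qV m) - k * (F q1 + F p1) - (2 - c) * F (pV m)"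
  proof -
    have "(2 + c) * ?\<alpha> = k" "(2 + c) * ?\<beta> = 2 - c"
      using c by (simp_all add: \<alpha>_coeff_def \<beta>_coeff_def c_def[symmetric])
    then show ?thesis
      unfolding Fz by (simp add: right_diff_distrib distrib_left mult.assoc[symmetric])
  qed
  also have "\<dots> = 2 * (F (qV m) - F (pV m) - k / 2 * (F p1 + F q1)
      + 1 / \<tau> m * (k / 2 * (F (pV m) + F (qV m))))"
    by (simp add: c_def algebra_simps)
  also have "\<dots> = 0"
    by (simp only: eq)
  finally have "F z = 0"
    using c by simp
  then have "z x = 0"
    using aV_definite[OF m z _ x] by (simp add: F_def)
  then have "qV m x = e x"
    by (simp add: z_def)
  then show ?thesis
    by (simp add: e_def y_def)
qed

text \<open>
  After eliminating the internal variables, both methods solve the same linear system for velocity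
  and displacement. Testing the difference of the two solutions with itself gives uniqueness: the
  two elastic coupling terms cancel by symmetry.
\<close>

lemma reduced_step_eq_complete_step:
  assumes k: "k > 0" and L: "L (\<lambda>x. 0) = 0"
    and S: "p1 \<in> S" "q1 \<in> S" "\<And>m. m \<in> {1..M} \<Longrightarrow> pV m \<in> S" "\<And>m. m \<in> {1..M} \<Longrightarrow> qV m \<in> S"
      "p0 \<in> S" "q0 \<in> S"
    and S': "q1' \<in> S" "q0' \<in> S"
    and p': "\<And>x. x \<in> X \<Longrightarrow> p1' x = p1 x" "\<And>x. x \<in> X \<Longrightarrow> p0' x = p0 x"
      "\<And>m x. m \<in> {1..M} \<Longrightarrow> x \<in> X \<Longrightarrow> pV' m x = pV m x"
    and complete: "complete_step k L (p1, p0, pV) (q1, q0, qV)"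
    and reduced: "reduced_step k L (p1', p0', pV') (q1', q0')"
    and x: "x \<in> X"
  shows "q1' x = q1 x \<and> q0' x = q0 x"
proof -
  let ?o = "\<lambda>x. 0 :: real^3"
  define d1 where "d1 = (\<lambda>x. q1' x - q1 x)"
  define d0 where "d0 = (\<lambda>x. q0' x - q0 x)"
  have d1: "d1 \<in> S"
    by (rule subspace_onD[OF sub S'(1) S(2), of _ 1 "- 1"]) (simp add: d1_def)
  have d0: "d0 \<in> S"
    by (rule subspace_onD[OF sub S'(2) S(6), of _ 1 "- 1"]) (simp add: d0_def)
  have split: "F q1' = F q1 + F d1" "F q0' = F q0 + F d0" "F p1' = F p1" "F p0' = F p0"
    if F: "linear_on X S F" for F
    using linear_onD[OF F S(2) d1, of q1' 1 1] linear_onD[OF F S(6) d0, of q0' 1 1]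
      linear_on_cong[OF F S(1) p'(1)] linear_on_cong[OF F S(5) p'(2)]
    by (simp_all add: d1_def d0_def)
  note mass_split = split[OF bilinear_onD(1)[OF mass d1]]
  note aE1_split = split[OF bilinear_onD(1)[OF aE d1]]
  note aE0_split = split[OF bilinear_onD(1)[OF aE d0]]
  have zero_right: "b u ?o = 0" if "bilinear_on X S b" "u \<in> S" for b u
    using linear_on_zero[OF bilinear_onD(2)[OF that] zero] by simp
  \<comment> \<open>The test function is the difference of the solutions with zero internal part,
    which removes all terms that the reduced equation lacks.\<close>
  have "mass q1 d1 - mass p1 d1 + (aE q0 d0 - aE p0 d0) + (\<Sum>m=1..M. aV m (qV m) ?o - aV m (pV m) ?o)
       + (k / 2 * (aE p0 d1 + aE q0 d1) - k / 2 * (aE p1 d0 + aE q1 d0)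
         + (\<Sum>m=1..M. k / 2 * (aV m (pV m) d1 + aV m (qV m) d1) - k / 2 * (aV m p1 ?o + aV m q1 ?o)
              + 1 / \<tau> m * (k / 2 * (aV m (pV m) ?o + aV m (qV m) ?o)))) = L d1"
    using complete zero d1 d0 unfolding complete_step_def by simp
  then have C: "mass q1 d1 - mass p1 d1 + (aE q0 d0 - aE p0 d0)
       + (k / 2 * (aE p0 d1 + aE q0 d1) - k / 2 * (aE p1 d0 + aE q1 d0)
         + (\<Sum>m=1..M. k / 2 * (aV m (pV m) d1 + aV m (qV m) d1))) = L d1"
    by (simp add: zero_right[OF aV] S)
  have R: "mass q1' d1 - mass p1' d1 + (aE q0' d0 - aE p0' d0)
       + (k / 2 * (aE p0' d1 + aE q0' d1) - k / 2 * (aE p1' d0 + aE q1' d0)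
         + (\<Sum>m=1..M. \<alpha>_coeff k (\<tau> m) * (k / 2 * (aV m p1' d1 + aV m q1' d1))))
       = L d1 - k * (\<Sum>m=1..M. (1 + \<beta>_coeff k (\<tau> m)) / 2 * aV m (pV' m) d1)"
    using reduced d1 d0 unfolding reduced_step_def by simp
  \<comment> \<open>By the update formula, old plus new internal variable is \<alpha> times the sum
    of the velocities plus 1 + \<beta> times the old variable. The reduced side contains
    \<open>q1'\<close>, which differs from \<open>q1\<close> by \<open>d1\<close>; this leaves the
    remainder with \<open>aV m d1 d1\<close>.\<close>
  have "(\<Sum>m=1..M. \<alpha>_coeff k (\<tau> m) * (k / 2 * (aV m p1' d1 + aV m q1' d1)))
      + k * (\<Sum>m=1..M. (1 + \<beta>_coeff k (\<tau> m)) / 2 * aV m (pV' m) d1)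
      = (\<Sum>m=1..M. k / 2 * (aV m (pV m) d1 + aV m (qV m) d1))
      + (\<Sum>m=1..M. \<alpha>_coeff k (\<tau> m) * (k / 2) * aV m d1 d1)"
    unfolding sum_distrib_left sum.distrib[symmetric]
  proof (rule sum.cong[OF refl])
    fix m assume m: "m \<in> {1..M}"
    let ?\<alpha> = "\<alpha>_coeff k (\<tau> m)" and ?\<beta> = "\<beta>_coeff k (\<tau> m)"
    note F = bilinear_onD(1)[OF aV[OF m] d1]
    define y where "y = (\<lambda>x. 1 *\<^sub>R q1 x + 1 *\<^sub>R p1 x)"
    have y: "y \<in> S"
      by (rule subspace_onD[OF sub S(2,1), of _ 1 1]) (simp add: y_def)
    have "aV m y d1 = 1 * aV m q1 d1 + 1 * aV m p1 d1"
      by (rule linear_onD[OF F S(2,1)]) (simp add: y_def)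
    moreover have "aV m (qV m) d1 = ?\<alpha> * aV m y d1 + ?\<beta> * aV m (pV m) d1"
      by (rule linear_onD[OF F y S(3)[OF m]])
         (use complete_step_internal_variable[OF k L S complete m] in \<open>simp add: y_def\<close>)
    moreover have "aV m (pV' m) d1 = aV m (pV m) d1"
      by (rule linear_on_cong[OF F S(3)[OF m] p'(3)[OF m]])
    ultimately show "?\<alpha> * (k / 2 * (aV m p1' d1 + aV m q1' d1)) + k * ((1 + ?\<beta>) / 2 * aV m (pV' m) d1)
        = k / 2 * (aV m (pV m) d1 + aV m (qV m) d1) + ?\<alpha> * (k / 2) * aV m d1 d1"
      using split[OF F] by (simp add: algebra_simps add_divide_distrib)
  qed
  with C R have energy: "mass d1 d1 + aE d0 d0 + (k / 2 * aE d0 d1 - k / 2 * aE d1 d0)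
      + (\<Sum>m=1..M. \<alpha>_coeff k (\<tau> m) * (k / 2) * aV m d1 d1) = 0"
    unfolding mass_split aE1_split aE0_split by (simp add: algebra_simps)
  \<comment> \<open>The viscoelastic remainder is dissipative, since \<alpha> is nonnegative;
    dropping it leaves the upper bound zero for the energy of the difference.\<close>
  have "0 \<le> (\<Sum>m=1..M. \<alpha>_coeff k (\<tau> m) * (k / 2) * aV m d1 d1)"
    using k \<tau>_pos by (intro sum_nonneg mult_nonneg_nonneg aV_nonneg) (auto simp: \<alpha>_coeff_def intro!: divide_nonneg_pos add_pos_pos)
  with energy aE_sym[OF d0 d1] have "mass d1 d1 + aE d0 d0 \<le> 0"
    by simp
  from elastic_definite[OF d1 d0 this x] show ?thesis
    by (simp add: d1_def d0_def)
qed

end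

subsection \<open>The two discrete methods\<close>

lemma load_zero: "load \<Omega> \<Gamma>N f g (\<lambda>x. 0) = 0"
  by (simp add: load_def L2_inner_def)

section \<open>The finite element problem as an instance of the abstract step\<close>

locale fe_problem = bounded_open_domain \<Omega> for \<Omega> +
  fixes \<Gamma>D :: "point set" and Vh :: "field set" and M :: nat
    and \<rho> \<mu> lam :: real and \<kappa> \<tau> :: "nat \<Rightarrow> real"
  assumes Vh_V: "Vh \<subseteq> V_space \<Omega> \<Gamma>D"
    and Vh_continuous: "v \<in> Vh \<Longrightarrow> continuous_on (closure \<Omega>) v"
    and Vh_subspace: "subspace_on (closure \<Omega>) Vh"
    and Vh_nonempty: "Vh \<noteq> {}"
    and \<kappa>_pos: "m \<in> {1..M} \<Longrightarrow> \<kappa> m > 0" and \<tau>_pos: "m \<in> {1..M} \<Longrightarrow> \<tau> m > 0"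
    and spd: "symmetric_positive_definite \<Omega> M (state_space M (V_space \<Omega> \<Gamma>D)) (A_form \<Omega> \<rho> \<mu> lam M \<kappa>)"
begin

abbreviation mass :: "field \<Rightarrow> field \<Rightarrow> real" where
  "mass u v \<equiv> L2_inner (lebesgue_on \<Omega>) (\<lambda>x. \<rho> *\<^sub>R u x) v"

abbreviation aE :: "field \<Rightarrow> field \<Rightarrow> real" where
  "aE \<equiv> a_E \<Omega> \<mu> lam"

abbreviation aV :: "nat \<Rightarrow> field \<Rightarrow> field \<Rightarrow> real" where
  "aV m \<equiv> a_VE \<Omega> (\<kappa> m)"

lemma Vh_H1: "Vh \<subseteq> H1_fields \<Omega>"
  using Vh_V by (auto simp: V_space_def)

lemma Vh_zero: "(\<lambda>x. 0) \<in> Vh"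
proof -
  obtain v where "v \<in> Vh"
    using Vh_nonempty by blast
  then show ?thesis
    using subspace_onD[OF Vh_subspace, of v v _ 0 0] by simp
qed

lemma bilinear_Vh:
  "bilinear_on (closure \<Omega>) Vh mass" "bilinear_on (closure \<Omega>) Vh aE" "bilinear_on (closure \<Omega>) Vh (aV m)"
  using bilinear_on_mono[OF bilinear_L2 order_refl closure_subset] H1_fields_L2 Vh_H1
    bilinear_on_mono[OF bilinear_a_E Vh_H1 closure_subset]
    bilinear_on_mono[OF bilinear_a_VE Vh_H1 closure_subset]
  by blast+

lemma zero_if_state_null:
  assumes "state_null \<Omega> M (u1, u0, uV)"
  shows "u1 \<in> Vh \<Longrightarrow> x \<in> closure \<Omega> \<Longrightarrow> u1 x = 0"
    and "u0 \<in> Vh \<Longrightarrow> x \<in> closure \<Omega> \<Longrightarrow> u0 x = 0"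
    and "m \<in> {1..M} \<Longrightarrow> uV m \<in> Vh \<Longrightarrow> x \<in> closure \<Omega> \<Longrightarrow> uV m x = 0"
proof -
  have AE: "AE x in lebesgue_on \<Omega>. u1 x = 0 \<and> u0 x = 0 \<and> (\<forall>m\<in>{1..M}. uV m x = 0)"
    using assms by simp
  show "u1 x = 0" if "u1 \<in> Vh" "x \<in> closure \<Omega>"
    using AE by (intro zero_on_closure_if_AE_zero Vh_continuous that) (auto elim!: eventually_mono)
  show "u0 x = 0" if "u0 \<in> Vh" "x \<in> closure \<Omega>"
    using AE by (intro zero_on_closure_if_AE_zero Vh_continuous that) (auto elim!: eventually_mono)
  show "uV m x = 0" if "m \<in> {1..M}" "uV m \<in> Vh" "x \<in> closure \<Omega>"
    by (rule zero_on_closure_if_AE_zero[OF Vh_continuous[OF that(2)] _ that(3)], rule eventually_mono[OF AE])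
       (use that(1) in blast)
qed

lemma A_form_definite:
  assumes "u1 \<in> Vh" "u0 \<in> Vh" "\<And>m. m \<in> {1..M} \<Longrightarrow> uV m \<in> Vh"
    and "mass u1 u1 + aE u0 u0 + (\<Sum>m=1..M. aV m (uV m) (uV m)) \<le> 0"
  shows "state_null \<Omega> M (u1, u0, uV)"
proof (rule ccontr)
  assume "\<not> state_null \<Omega> M (u1, u0, uV)"
  moreover have "(u1, u0, uV) \<in> state_space M (V_space \<Omega> \<Gamma>D)"
    using assms Vh_V by (auto simp: state_space_def)
  ultimately have "A_form \<Omega> \<rho> \<mu> lam M \<kappa> (u1, u0, uV) (u1, u0, uV) > 0"
    using spd unfolding symmetric_positive_definite_def by blast
  with assms(4) show False by simp
qed

lemma bilinear_zero:
  assumes "bilinear_on (closure \<Omega>) Vh b" "u \<in> Vh"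
  shows "b (\<lambda>x. 0) u = 0" "b u (\<lambda>x. 0) = 0"
  using linear_on_zero[OF bilinear_onD(1)[OF assms] Vh_zero]
    linear_on_zero[OF bilinear_onD(2)[OF assms] Vh_zero] by simp_all

text \<open>Symmetry and definiteness are read off the single hypothesis on \<open>A\<close> by
  states whose remaining components are zero: displacement alone for symmetry, one internal variable
  alone for its own form, velocity with displacement for the joint condition. Nonnegativity of
  \<open>aV\<close> comes from \<kappa> > 0, as the integral of a multiple of a square.\<close>

sublocale viscoelastic_forms "closure \<Omega>" Vh M \<tau> mass aE aV
proof
  show "subspace_on (closure \<Omega>) Vh" by (rule Vh_subspace)
  show "(\<lambda>x. 0) \<in> Vh" by (rule Vh_zero)
  show "bilinear_on (closure \<Omega>) Vh mass" "bilinear_on (closure \<Omega>) Vh aE" by (rule bilinear_Vh)+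
  show "bilinear_on (closure \<Omega>) Vh (aV m)" for m by (rule bilinear_Vh)
  show "0 < \<tau> m" if "m \<in> {1..M}" for m using that by (rule \<tau>_pos)
  show "0 \<le> aV m u u" if "m \<in> {1..M}" for m u
    using \<kappa>_pos[OF that] by (intro a_VE_nonneg) simp
  show "aE u v = aE v u" if "u \<in> Vh" "v \<in> Vh" for u v
  proof -
    let ?s = "\<lambda>u. (\<lambda>x. 0, u, \<lambda>m x. 0) :: state"
    have "?s u \<in> state_space M (V_space \<Omega> \<Gamma>D)" "?s v \<in> state_space M (V_space \<Omega> \<Gamma>D)"
      using that Vh_zero Vh_V by (auto simp: state_space_def)
    then have "A_form \<Omega> \<rho> \<mu> lam M \<kappa> (?s u) (?s v) = A_form \<Omega> \<rho> \<mu> lam M \<kappa> (?s v) (?s u)"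
      using spd unfolding symmetric_positive_definite_def by blast
    then show ?thesis
      by (simp add: bilinear_zero[OF bilinear_Vh(1) Vh_zero, simplified] bilinear_zero[OF bilinear_Vh(3) Vh_zero])
  qed
  show "u x = 0" if m: "m \<in> {1..M}" and u: "u \<in> Vh" and le: "aV m u u \<le> 0" and x: "x \<in> closure \<Omega>" for m u x
  proof -
    define uV where "uV = (\<lambda>j. if j = m then u else (\<lambda>x. 0))"
    have uV: "uV j \<in> Vh" for j
      using u Vh_zero by (simp add: uV_def)
    have "(\<Sum>j=1..M. aV j (uV j) (uV j)) = aV m u u"
      using m by (subst sum.remove[of _ m])
        (auto simp: uV_def bilinear_zero[OF bilinear_Vh(3) Vh_zero] intro!: sum.neutral)
    then have "state_null \<Omega> M (\<lambda>x. 0, \<lambda>x. 0, uV)"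
      using le by (intro A_form_definite uV Vh_zero)
        (simp add: bilinear_zero[OF bilinear_Vh(1) Vh_zero, simplified] bilinear_zero[OF bilinear_Vh(2) Vh_zero])
    from zero_if_state_null(3)[OF this m uV x] show ?thesis
      by (simp add: uV_def)
  qed
  show "u x = 0 \<and> v x = 0" if uv: "u \<in> Vh" "v \<in> Vh" and le: "mass u u + aE v v \<le> 0" and x: "x \<in> closure \<Omega>" for u v x
  proof -
    have "state_null \<Omega> M (u, v, \<lambda>m x. 0)"
      using le by (intro A_form_definite uv Vh_zero) (simp add: bilinear_zero[OF bilinear_Vh(3) Vh_zero])
    from zero_if_state_null(1,2)[OF this] show ?thesis
      using uv x by simp
  qed
qed

text \<open>Test functions constant in time make each term a linear functional of the solution or of
  its time derivative, so the integral is evaluated term by term. The load enters only through its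
  total \<open>L w1\<close>.\<close>

lemma complete_cell_step:
  assumes lr: "l < r"
    and U: "U1 \<in> P1_time (closure \<Omega>) {l<..r} Vh" "right_continuous (closure \<Omega>) U1 l"
      "U0 \<in> P1_time (closure \<Omega>) {l<..r} Vh" "right_continuous (closure \<Omega>) U0 l"
    and UV: "\<And>m. m \<in> {1..M} \<Longrightarrow> UV m \<in> P1_time (closure \<Omega>) {l<..r} Vh"
      "\<And>m. m \<in> {1..M} \<Longrightarrow> right_continuous (closure \<Omega>) (UV m) l"
    and eq: "\<And>w1 w0 wV. w1 \<in> Vh \<Longrightarrow> w0 \<in> Vh \<Longrightarrow> (\<And>m. m \<in> {1..M} \<Longrightarrow> wV m \<in> Vh) \<Longrightarrow>
      (\<integral>s. A_form \<Omega> \<rho> \<mu> lam M \<kappa>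
            (time_deriv {l<..r} U1 s, time_deriv {l<..r} U0 s, \<lambda>m. time_deriv {l<..r} (UV m) s) (w1, w0, wV)
          + B_form \<Omega> \<mu> lam M \<kappa> \<tau> (U1 s, U0 s, \<lambda>m. UV m s) (w1, w0, wV) \<partial>lebesgue_on {l<..r}) = L w1"
  shows "complete_step (r - l) L (U1 l, U0 l, \<lambda>m. UV m l) (U1 r, U0 r, \<lambda>m. UV m r)"
  unfolding complete_step_def prod.case
proof (intro ballI allI impI)
  fix w1 w0 wV assume w: "w1 \<in> Vh" "w0 \<in> Vh" "\<forall>m\<in>{1..M}. wV m \<in> Vh"
  note P1 = has_bochner_integral_P1_time[OF _ Vh_subspace _ _ lr]
  note lin = bilinear_onD(1)
  note I1 = P1[OF _ U(1,2)] and I0 = P1[OF _ U(3,4)]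
  have IV: "has_bochner_integral (lebesgue_on {l<..r}) (\<lambda>s. aV m (UV m s) w) ((r - l) / 2 * (aV m (UV m l) w + aV m (UV m r) w))"
    "has_bochner_integral (lebesgue_on {l<..r}) (\<lambda>s. aV m (time_deriv {l<..r} (UV m) s) w) (aV m (UV m r) w - aV m (UV m l) w)"
    if "m \<in> {1..M}" "w \<in> Vh" for m w
    using P1[OF lin[OF bilinear_Vh(3) that(2)] UV[OF that(1)]] by auto
  have "has_bochner_integral (lebesgue_on {l<..r})
      (\<lambda>s. mass (time_deriv {l<..r} U1 s) w1 + aE (time_deriv {l<..r} U0 s) w0
        + (\<Sum>m=1..M. aV m (time_deriv {l<..r} (UV m) s) (wV m))
        + (aE (U0 s) w1 - aE (U1 s) w0
          + (\<Sum>m=1..M. aV m (UV m s) w1 - aV m (U1 s) (wV m) + 1 / \<tau> m * aV m (UV m s) (wV m))))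
      (mass (U1 r) w1 - mass (U1 l) w1 + (aE (U0 r) w0 - aE (U0 l) w0)
        + (\<Sum>m=1..M. aV m (UV m r) (wV m) - aV m (UV m l) (wV m))
        + ((r - l) / 2 * (aE (U0 l) w1 + aE (U0 r) w1) - (r - l) / 2 * (aE (U1 l) w0 + aE (U1 r) w0)
          + (\<Sum>m=1..M. (r - l) / 2 * (aV m (UV m l) w1 + aV m (UV m r) w1)
              - (r - l) / 2 * (aV m (U1 l) (wV m) + aV m (U1 r) (wV m))
              + 1 / \<tau> m * ((r - l) / 2 * (aV m (UV m l) (wV m) + aV m (UV m r) (wV m))))))"
    using w
    by (intro has_bochner_integral_add has_bochner_integral_diff has_bochner_integral_sum
        has_bochner_integral_mult_right IV I1[OF lin[OF bilinear_Vh(1)]] I1[OF lin[OF bilinear_Vh(2)]]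
        I1[OF lin[OF bilinear_Vh(3)]] I0[OF lin[OF bilinear_Vh(2)]]) auto
  from has_bochner_integral_integral_eq[OF this] eq[OF w(1,2), of wV] w(3)
  show "mass (U1 r) w1 - mass (U1 l) w1 + (aE (U0 r) w0 - aE (U0 l) w0)
        + (\<Sum>m=1..M. aV m (UV m r) (wV m) - aV m (UV m l) (wV m))
        + ((r - l) / 2 * (aE (U0 l) w1 + aE (U0 r) w1) - (r - l) / 2 * (aE (U1 l) w0 + aE (U1 r) w0)
          + (\<Sum>m=1..M. (r - l) / 2 * (aV m (UV m l) w1 + aV m (UV m r) w1)
              - (r - l) / 2 * (aV m (U1 l) (wV m) + aV m (U1 r) (wV m))
              + 1 / \<tau> m * ((r - l) / 2 * (aV m (UV m l) (wV m) + aV m (UV m r) (wV m))))) = L w1"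
    by simp
qed

text \<open>In contrast to the complete method, the old internal variables sit inside the load
  integral. Integrability of the load lets that integral split, and the constant part picks up the
  factor \<open>r - l\<close>. Membership of \<open>pV\<close> in \<open>Vh\<close> is what allows
  scalars to be pulled out of \<open>aV\<close>.\<close>

lemma reduced_cell_step:
  assumes lr: "l < r"
    and U: "U1 \<in> P1_time (closure \<Omega>) {l<..r} Vh" "right_continuous (closure \<Omega>) U1 l"
      "U0 \<in> P1_time (closure \<Omega>) {l<..r} Vh" "right_continuous (closure \<Omega>) U0 l"
    and pV: "\<And>m. m \<in> {1..M} \<Longrightarrow> pV m \<in> Vh"
    and load: "\<And>w. w \<in> Vh \<Longrightarrow> integrable (lebesgue_on {l<..r}) (\<lambda>s. load \<Omega> \<Gamma>N (f s) (g s) w)"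
    and eq: "\<And>w1 w0. w1 \<in> Vh \<Longrightarrow> w0 \<in> Vh \<Longrightarrow>
      (\<integral>s. Ar_form \<Omega> \<rho> \<mu> lam (time_deriv {l<..r} U1 s, time_deriv {l<..r} U0 s) (w1, w0)
          + Br_form \<Omega> \<mu> lam M \<kappa> \<tau> (r - l) (U1 s, U0 s) (w1, w0) \<partial>lebesgue_on {l<..r})
      = (\<integral>s. reduced_load \<Omega> \<Gamma>N M \<kappa> \<tau> (r - l) pV (f s) (g s) w1 \<partial>lebesgue_on {l<..r})"
  shows "reduced_step (r - l) (\<lambda>w. \<integral>s. load \<Omega> \<Gamma>N (f s) (g s) w \<partial>lebesgue_on {l<..r})
    (U1 l, U0 l, pV) (U1 r, U0 r)"
  unfolding reduced_step_def prod.case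
proof (intro ballI)
  fix w1 w0 assume w: "w1 \<in> Vh" "w0 \<in> Vh"
  let ?\<alpha> = "\<lambda>m. \<alpha>_coeff (r - l) (\<tau> m)" and ?\<beta> = "\<lambda>m. \<beta>_coeff (r - l) (\<tau> m)"
  note P1 = has_bochner_integral_P1_time[OF _ Vh_subspace _ _ lr]
  note lin = bilinear_onD(1)
  note I1 = P1[OF _ U(1,2)] and I0 = P1[OF _ U(3,4)]
  have scale: "aV m (\<lambda>x. c *\<^sub>R u x) w1 = c * aV m u w1" if "u \<in> Vh" for m c u
    using linear_onD[OF lin[OF bilinear_Vh(3) w(1)] that that, of "\<lambda>x. c *\<^sub>R u x" c 0] by simp
  have U_Vh: "U1 s \<in> Vh" if "s \<in> {l<..r}" for s
    using that by (intro P1_time_endpoints(3)[OF U(1,2) lr Vh_subspace]) auto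
  have "has_bochner_integral (lebesgue_on {l<..r})
      (\<lambda>s. mass (time_deriv {l<..r} U1 s) w1 + aE (time_deriv {l<..r} U0 s) w0
        + (aE (U0 s) w1 - aE (U1 s) w0 + (\<Sum>m=1..M. ?\<alpha> m * aV m (U1 s) w1)))
      (mass (U1 r) w1 - mass (U1 l) w1 + (aE (U0 r) w0 - aE (U0 l) w0)
        + ((r - l) / 2 * (aE (U0 l) w1 + aE (U0 r) w1) - (r - l) / 2 * (aE (U1 l) w0 + aE (U1 r) w0)
          + (\<Sum>m=1..M. ?\<alpha> m * ((r - l) / 2 * (aV m (U1 l) w1 + aV m (U1 r) w1)))))"
    (is "has_bochner_integral _ ?F ?I")
    using w
    by (intro has_bochner_integral_add has_bochner_integral_diff has_bochner_integral_sum
        has_bochner_integral_mult_right I1[OF lin[OF bilinear_Vh(1)]] I1[OF lin[OF bilinear_Vh(2)]]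
        I1[OF lin[OF bilinear_Vh(3)]] I0[OF lin[OF bilinear_Vh(2)]]) auto
  then have "?I = (\<integral>s. ?F s \<partial>lebesgue_on {l<..r})"
    by (simp add: has_bochner_integral_integral_eq)
  also have "\<dots> = (\<integral>s. Ar_form \<Omega> \<rho> \<mu> lam (time_deriv {l<..r} U1 s, time_deriv {l<..r} U0 s) (w1, w0)
          + Br_form \<Omega> \<mu> lam M \<kappa> \<tau> (r - l) (U1 s, U0 s) (w1, w0) \<partial>lebesgue_on {l<..r})"
    by (rule Bochner_Integration.integral_cong) (auto simp: scale[OF U_Vh])
  also have "\<dots> = (\<integral>s. reduced_load \<Omega> \<Gamma>N M \<kappa> \<tau> (r - l) pV (f s) (g s) w1 \<partial>lebesgue_on {l<..r})"
    by (rule eq[OF w])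
  also have "\<dots> = (\<integral>s. load \<Omega> \<Gamma>N (f s) (g s) w1 - (\<Sum>m=1..M. (1 + ?\<beta> m) / 2 * aV m (pV m) w1) \<partial>lebesgue_on {l<..r})"
    unfolding reduced_load_def by (simp add: scale[OF pV])
  also have "\<dots> = (\<integral>s. load \<Omega> \<Gamma>N (f s) (g s) w1 \<partial>lebesgue_on {l<..r})
      - (r - l) * (\<Sum>m=1..M. (1 + ?\<beta> m) / 2 * aV m (pV m) w1)"
    using has_bochner_integral_const_half_open[of l r "\<Sum>m=1..M. (1 + ?\<beta> m) / 2 * aV m (pV m) w1"] lr load[OF w(1)]
    by (subst Bochner_Integration.integral_diff) (auto simp: has_bochner_integral_iff)
  finally show "?I = (\<integral>s. load \<Omega> \<Gamma>N (f s) (g s) w1 \<partial>lebesgue_on {l<..r})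
      - (r - l) * (\<Sum>m=1..M. (1 + ?\<beta> m) / 2 * aV m (pV m) w1)" .
qed

text \<open>At the right end, velocity and displacement agree by uniqueness of the reduced step; the
  internal variables then agree because the update derived for the complete method and the
  prescribed one have equal right-hand sides. Both solutions interpolate affinely in between, for
  which affinity in time with coefficients in \<open>UNIV\<close> is enough.\<close>

lemma cell_agreement:
  assumes lr: "l < r"
    and U: "U1 \<in> P1_time (closure \<Omega>) {l<..r} Vh" "right_continuous (closure \<Omega>) U1 l"
      "U0 \<in> P1_time (closure \<Omega>) {l<..r} Vh" "right_continuous (closure \<Omega>) U0 l"
    and UV: "\<And>m. m \<in> {1..M} \<Longrightarrow> UV m \<in> P1_time (closure \<Omega>) {l<..r} Vh"
      "\<And>m. m \<in> {1..M} \<Longrightarrow> right_continuous (closure \<Omega>) (UV m) l"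
    and U': "U1' \<in> P1_time (closure \<Omega>) {l<..r} Vh" "right_continuous (closure \<Omega>) U1' l"
      "U0' \<in> P1_time (closure \<Omega>) {l<..r} Vh" "right_continuous (closure \<Omega>) U0' l"
    and UV': "\<And>m. m \<in> {1..M} \<Longrightarrow> UV' m \<in> P1_time (closure \<Omega>) {l<..r} UNIV"
      "\<And>m. m \<in> {1..M} \<Longrightarrow> right_continuous (closure \<Omega>) (UV' m) l"
    and L: "L (\<lambda>x. 0) = 0"
    and complete: "complete_step (r - l) L (U1 l, U0 l, \<lambda>m. UV m l) (U1 r, U0 r, \<lambda>m. UV m r)"
    and reduced: "reduced_step (r - l) L (U1' l, U0' l, \<lambda>m. UV' m l) (U1' r, U0' r)"
    and update: "\<And>m x. m \<in> {1..M} \<Longrightarrow> x \<in> closure \<Omega> \<Longrightarrow> UV' m r x =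
      \<alpha>_coeff (r - l) (\<tau> m) *\<^sub>R (U1' r x + U1' l x) + \<beta>_coeff (r - l) (\<tau> m) *\<^sub>R UV' m l x"
    and start: "state_eq_on (closure \<Omega>) M (U1' l, U0' l, \<lambda>m. UV' m l) (U1 l, U0 l, \<lambda>m. UV m l)"
    and s: "s \<in> {l..r}"
  shows "state_eq_on (closure \<Omega>) M (U1' s, U0' s, \<lambda>m. UV' m s) (U1 s, U0 s, \<lambda>m. UV m s)"
proof -
  have k: "r - l > 0" using lr by simp
  have lr': "l \<in> {l..r}" "r \<in> {l..r}" using lr by auto
  note mem = P1_time_endpoints(3)[OF _ _ lr Vh_subspace]
  have start': "U1' l x = U1 l x" "U0' l x = U0 l x" "\<And>m. m \<in> {1..M} \<Longrightarrow> UV' m l x = UV m l x"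
    if "x \<in> closure \<Omega>" for x
    using start that by auto
  have "U1' r x = U1 r x \<and> U0' r x = U0 r x" if "x \<in> closure \<Omega>" for x
    by (rule reduced_step_eq_complete_step[OF k L _ _ _ _ _ _ _ _ _ _ _ complete reduced that])
       (use lr' start' in \<open>auto intro: mem[OF U(1,2)] mem[OF U(3,4)] mem[OF UV] mem[OF U'(1,2)] mem[OF U'(3,4)]\<close>)
  then have end1: "U1' r x = U1 r x" and end0: "U0' r x = U0 r x" if "x \<in> closure \<Omega>" for x
    using that by auto
  have endV: "UV' m r x = UV m r x" if m: "m \<in> {1..M}" and x: "x \<in> closure \<Omega>" for m x
  proof -
    have "UV m r x = \<alpha>_coeff (r - l) (\<tau> m) *\<^sub>R (U1 r x + U1 l x) + \<beta>_coeff (r - l) (\<tau> m) *\<^sub>R UV m l x"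
      by (rule complete_step_internal_variable[OF k L _ _ _ _ _ _ complete m x])
         (use lr' in \<open>auto intro: mem[OF U(1,2)] mem[OF U(3,4)] mem[OF UV]\<close>)
    then show ?thesis
      using update[OF m x] start'(1)[OF x] start'(3)[OF x m] end1[OF x] by simp
  qed
  note interp = P1_time_endpoints(1)[OF _ _ lr s]
  show ?thesis
    unfolding state_eq_on.simps
    using start' end1 end0 endV interp[OF U(1,2)] interp[OF U(3,4)] interp[OF U'(1,2)] interp[OF U'(3,4)]
      interp[OF UV] interp[OF UV']
    by simp
qed

end

section \<open>Propagation of agreement over the time grid\<close>

theorem mainTheorem2:
  fixes \<Omega> \<Gamma>D \<Gamma>N :: "point set" and \<T> :: "point set set" and p N M :: nat
    and \<rho> \<mu> lam T :: real and \<kappa> \<tau> t :: "nat \<Rightarrow> real"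
    and f g :: "real \<Rightarrow> field" and init :: state
    and U1 U0 U1' U0' :: "real \<Rightarrow> field" and UVE UVE' :: "nat \<Rightarrow> real \<Rightarrow> field"
  defines "Vh \<equiv> FE_space \<Omega> \<Gamma>D \<T> p"
  assumes domain: "open \<Omega>" "connected \<Omega>" "\<Omega> \<noteq> {}" "bounded \<Omega>" "piecewise_smooth_boundary \<Omega>"
    and boundary: "frontier \<Omega> = \<Gamma>D \<union> \<Gamma>N" "\<Gamma>D \<inter> \<Gamma>N = {}"
      "\<Gamma>D \<in> sets borel" "\<Gamma>N \<in> sets borel" "emeasure area_measure \<Gamma>D > 0"
    and parameters: "\<rho> > 0" "1 \<le> M" "\<And>m. m \<in> {1..M} \<Longrightarrow> \<kappa> m > 0" "\<And>m. m \<in> {1..M} \<Longrightarrow> \<tau> m > 0"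
    and A_spd: "symmetric_positive_definite \<Omega> M (state_space M (V_space \<Omega> \<Gamma>D)) (A_form \<Omega> \<rho> \<mu> lam M \<kappa>)"
    and mesh: "tetrahedral_mesh \<Omega> \<T>"
    and grid: "time_grid N T t"
    and force: "L1_in_time_L2 \<Omega> T f"
    and traction: "piecewise_linear_in_time \<Gamma>N N t g"
    and init: "init \<in> state_space M Vh"
    and complete: "complete_method \<Omega> \<Gamma>N \<rho> \<mu> lam M \<kappa> \<tau> f g Vh N t init U1 U0 UVE"
    and reduced: "reduced_method \<Omega> \<Gamma>N \<rho> \<mu> lam M \<kappa> \<tau> f g Vh N t init U1' U0' UVE'"
  shows "\<forall>s\<in>{0..T}. state_eq_on (closure \<Omega>) M
           (U1' s, U0' s, \<lambda>m. UVE' m s) (U1 s, U0 s, \<lambda>m. UVE m s)"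
proof -
  interpret bounded_open_domain \<Omega>
    using domain by unfold_locales
  have "\<And>K. K \<in> \<T> \<Longrightarrow> K \<subseteq> closure \<Omega>"
    using mesh by (auto simp: tetrahedral_mesh_def)
  then have sub: "subspace_on (closure \<Omega>) Vh"
    unfolding Vh_def by (rule subspace_on_FE_space)
  interpret fe_problem \<Omega> \<Gamma>D Vh M \<rho> \<mu> lam \<kappa> \<tau>
  proof
    show "Vh \<subseteq> V_space \<Omega> \<Gamma>D" "\<And>v. v \<in> Vh \<Longrightarrow> continuous_on (closure \<Omega>) v"
      by (auto simp: Vh_def FE_space_def)
    show "Vh \<noteq> {}"
      using init by (auto simp: state_space_def)
  qed (use sub parameters A_spd in auto)
  have t0: "t 0 = 0" and tN: "t N = T" and t_less: "\<And>n. n \<in> {1..N} \<Longrightarrow> t (n - 1) < t n"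
    using grid by (auto simp: time_grid_def)
  have t_mono: "t i \<le> t j" if "i \<le> j" "j \<le> N" for i j
    using that
  proof (induction j rule: dec_induct)
    case (step j)
    with t_less[of "Suc j"] show ?case by simp
  qed simp
  \<comment> \<open>The conclusion includes the right end of the cell, which supplies the premise
    \<open>start\<close> for the next one.\<close>
  have cell: "state_eq_on (closure \<Omega>) M (U1' s, U0' s, \<lambda>m. UVE' m s) (U1 s, U0 s, \<lambda>m. UVE m s)"
    if n: "n \<in> {1..N}" and s: "s \<in> {t (n - 1)..t n}"
      and start: "state_eq_on (closure \<Omega>) M
        (U1' (t (n - 1)), U0' (t (n - 1)), \<lambda>m. UVE' m (t (n - 1)))
        (U1 (t (n - 1)), U0 (t (n - 1)), \<lambda>m. UVE m (t (n - 1)))" for n s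
  proof -
    let ?l = "t (n - 1)" and ?r = "t n"
    let ?L = "\<lambda>w. \<integral>s. load \<Omega> \<Gamma>N (f s) (g s) w \<partial>lebesgue_on {?l<..?r}"
    note C = complete[unfolded complete_method_def Let_def time_cell_def, THEN conjunct2, rule_format, OF n]
    note R = reduced[unfolded reduced_method_def Let_def time_cell_def time_step_def, THEN conjunct2,
        rule_format, OF n]
    have lr: "?l < ?r" using t_less[OF n] .
    have C_space: "U1 \<in> P1_time (closure \<Omega>) {?l<..?r} Vh" "right_continuous (closure \<Omega>) U1 ?l"
        "U0 \<in> P1_time (closure \<Omega>) {?l<..?r} Vh" "right_continuous (closure \<Omega>) U0 ?l"
        "\<And>m. m \<in> {1..M} \<Longrightarrow> UVE m \<in> P1_time (closure \<Omega>) {?l<..?r} Vh"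
        "\<And>m. m \<in> {1..M} \<Longrightarrow> right_continuous (closure \<Omega>) (UVE m) ?l"
      using C by blast+
    have R_space: "U1' \<in> P1_time (closure \<Omega>) {?l<..?r} Vh" "right_continuous (closure \<Omega>) U1' ?l"
        "U0' \<in> P1_time (closure \<Omega>) {?l<..?r} Vh" "right_continuous (closure \<Omega>) U0' ?l"
        "\<And>m. m \<in> {1..M} \<Longrightarrow> UVE' m \<in> P1_time (closure \<Omega>) {?l<..?r} UNIV"
        "\<And>m. m \<in> {1..M} \<Longrightarrow> right_continuous (closure \<Omega>) (UVE' m) ?l"
      using R by blast+
    have load: "integrable (lebesgue_on {?l<..?r}) (\<lambda>s. load \<Omega> \<Gamma>N (f s) (g s) w)" if w: "w \<in> Vh" for w
    proof (rule integrable_load[OF force _ _ lmeasurable_domain])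
      show "g \<in> P1_time \<Gamma>N {?l<..?r} (L2_space (restrict_space area_measure \<Gamma>N))"
        using traction n by (simp add: piecewise_linear_in_time_def time_cell_def)
      show "w \<in> L2_space (lebesgue_on \<Omega>)"
        using w Vh_H1 H1_fields_L2 by blast
      show "0 \<le> ?l" "?r \<le> T"
        using t_mono[of 0 "n - 1"] t_mono[of n N] n t0 tN by auto
    qed
    have C_step: "complete_step (?r - ?l) ?L (U1 ?l, U0 ?l, \<lambda>m. UVE m ?l) (U1 ?r, U0 ?r, \<lambda>m. UVE m ?r)"
    proof (rule complete_cell_step[OF lr C_space])
      fix w1 w0 wV assume "w1 \<in> Vh" "w0 \<in> Vh" "\<And>m. m \<in> {1..M} \<Longrightarrow> wV m \<in> Vh"
      then have "(\<lambda>s. w1) \<in> P0_time (closure \<Omega>) {?l<..?r} Vh" "(\<lambda>s. w0) \<in> P0_time (closure \<Omega>) {?l<..?r} Vh"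
          "\<forall>m\<in>{1..M}. (\<lambda>s. wV m) \<in> P0_time (closure \<Omega>) {?l<..?r} Vh"
        by (auto intro: P0_time_const)
      with C[THEN conjunct2, THEN conjunct2, THEN conjunct2, THEN conjunct2, THEN conjunct2, THEN conjunct2,
          rule_format, of "\<lambda>s. w1" "\<lambda>s. w0" "\<lambda>m s. wV m"]
      show "(\<integral>s. A_form \<Omega> \<rho> \<mu> lam M \<kappa>
            (time_deriv {?l<..?r} U1 s, time_deriv {?l<..?r} U0 s, \<lambda>m. time_deriv {?l<..?r} (UVE m) s) (w1, w0, wV)
          + B_form \<Omega> \<mu> lam M \<kappa> \<tau> (U1 s, U0 s, \<lambda>m. UVE m s) (w1, w0, wV) \<partial>lebesgue_on {?l<..?r}) = ?L w1"
        by blast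
    qed
    \<comment> \<open>The reduced method puts no finite element constraint on \<open>UVE'\<close>.
      Its value at the left end lies in \<open>Vh\<close> because it coincides on
      \<open>closure \<Omega>\<close> with that of the complete method, and membership in
      \<open>Vh\<close> ignores values elsewhere.\<close>
    have pV: "UVE' m ?l \<in> Vh" if m: "m \<in> {1..M}" for m
    proof -
      have "UVE m ?l \<in> Vh"
        using lr by (intro P1_time_endpoints(3)[OF C_space(5,6)[OF m] lr sub]) auto
      then show ?thesis
        using subspace_onD[OF sub, of "UVE m ?l" "UVE m ?l" "UVE' m ?l" 1 0] start m by simp
    qed
    have R_step: "reduced_step (?r - ?l) ?L (U1' ?l, U0' ?l, \<lambda>m. UVE' m ?l) (U1' ?r, U0' ?r)"
    proof (rule reduced_cell_step[OF lr R_space(1-4) pV load])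
      fix w1 w0 assume "w1 \<in> Vh" "w0 \<in> Vh"
      then have "(\<lambda>s. w1) \<in> P0_time (closure \<Omega>) {?l<..?r} Vh" "(\<lambda>s. w0) \<in> P0_time (closure \<Omega>) {?l<..?r} Vh"
        by (auto intro: P0_time_const)
      with R[THEN conjunct2, THEN conjunct2, THEN conjunct2, THEN conjunct2, THEN conjunct2, THEN conjunct2,
          THEN conjunct1, rule_format, of "\<lambda>s. w1" "\<lambda>s. w0"]
      show "(\<integral>s. Ar_form \<Omega> \<rho> \<mu> lam (time_deriv {?l<..?r} U1' s, time_deriv {?l<..?r} U0' s) (w1, w0)
            + Br_form \<Omega> \<mu> lam M \<kappa> \<tau> (?r - ?l) (U1' s, U0' s) (w1, w0) \<partial>lebesgue_on {?l<..?r})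
          = (\<integral>s. reduced_load \<Omega> \<Gamma>N M \<kappa> \<tau> (?r - ?l) (\<lambda>m. UVE' m ?l) (f s) (g s) w1 \<partial>lebesgue_on {?l<..?r})"
        by blast
    qed
    show ?thesis
    proof (rule cell_agreement[OF lr C_space R_space _ C_step R_step _ start s])
      show "?L (\<lambda>x. 0) = 0"
        by (simp add: load_zero)
      show "UVE' m ?r x = \<alpha>_coeff (?r - ?l) (\<tau> m) *\<^sub>R (U1' ?r x + U1' ?l x)
          + \<beta>_coeff (?r - ?l) (\<tau> m) *\<^sub>R UVE' m ?l x" if "m \<in> {1..M}" "x \<in> closure \<Omega>" for m x
        using R that by blast
    qed
  qed
  \<comment> \<open>The claim covers all times up to \<open>t n\<close>. In the induction step a
    later time lies in the closed cell with index \<open>Suc n\<close>, and agreement at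
    \<open>t n\<close> is the starting condition there.\<close>
  have "\<forall>s\<in>{0..t n}. state_eq_on (closure \<Omega>) M (U1' s, U0' s, \<lambda>m. UVE' m s) (U1 s, U0 s, \<lambda>m. UVE m s)"
    if "n \<le> N" for n
    using that
  proof (induction n)
    case 0
    \<comment> \<open>\<open>state_eq_on\<close> is defined by equations on triples, so the common
      initial state is split before the two initial conditions are chained.\<close>
    obtain i1 i0 iV where "init = (i1, i0, iV)"
      by (cases init)
    then have "state_eq_on (closure \<Omega>) M (U1' 0, U0' 0, \<lambda>m. UVE' m 0) (U1 0, U0 0, \<lambda>m. UVE m 0)"
      using complete reduced by (simp add: complete_method_def reduced_method_def t0)
    then show ?case by (simp add: t0)
  next
    case (Suc n)
    show ?case
    proof
      fix s assume s: "s \<in> {0..t (Suc n)}"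
      show "state_eq_on (closure \<Omega>) M (U1' s, U0' s, \<lambda>m. UVE' m s) (U1 s, U0 s, \<lambda>m. UVE m s)"
      proof (cases "s \<le> t n")
        case True
        then show ?thesis
          using Suc s by simp
      next
        case False
        have "t n \<in> {0..t n}"
          using t_mono[of 0 n] Suc.prems t0 by simp
        with Suc have "state_eq_on (closure \<Omega>) M (U1' (t n), U0' (t n), \<lambda>m. UVE' m (t n))
            (U1 (t n), U0 (t n), \<lambda>m. UVE m (t n))"
          by simp
        then show ?thesis
          using cell[of "Suc n" s] s False Suc.prems by simp
      qed
    qed
  qed
  from this[of N] show ?thesis
    by (simp add: tN)
qed

end
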